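(* For any integer $g\ge 3$ and any odd prime power $p\equiv 1\pmod 4$, there exists a $\frac{p+1}{2}$-regular oriented graph $D$ with directed girth at least $g$ such that ${\rm fas}(D)\ge \frac{p+1-2\sqrt p}{4(p+1)}\,a(D)$, and therefore ${\rm fasd}(D)\le \frac{4(p+1)}{p+1-2\sqrt p}$.
   Context: An oriented graph is a digraph without loops, multiple arcs or directed $2$-cycles. A digraph is $k$-regular if every vertex has in-degree and out-degree exactly $k$. Directed girth = minimum length of a directed cycle. ${\rm fas}(D)$ is the minimum size of a feedback arc set (set of arcs whose removal makes $D$ acyclic); $a(D)=|A(D)|$; ${\rm fasd}(D)$ is the maximum number $t$ such that $A(D)$ can be partitioned into $t$ feedback arc sets. *)

theory Defs
  imports
    Complex_Main
    "HOL-Library.Extended_Nat"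
    "HOL-Library.Disjoint_Sets"
    "HOL-Number_Theory.Cong"
    "HOL-Number_Theory.Prime_Powers"
    "Graph_Theory.Graph_Theory"
begin

locale oriented_graph = digraph +
  assumes no_2_cycles: "u \<rightarrow>\<^bsub>G\<^esub> v \<Longrightarrow> \<not> v \<rightarrow>\<^bsub>G\<^esub> u"

definition regular_digraph :: "nat \<Rightarrow> ('a, 'b) pre_digraph \<Rightarrow> bool" where
  "regular_digraph k D \<longleftrightarrow> (\<forall>v \<in> verts D. in_degree D v = k \<and> out_degree D v = k)"

text \<open>The directed girth of a digraph without directed cycles is \<open>\<infinity>\<close>.\<close>

definition directed_girth :: "('a, 'b) pre_digraph \<Rightarrow> enat" where
  "directed_girth D = (INF c \<in> {c. pre_digraph.cycle D c}. enat (length c))"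

definition acyclic_digraph :: "('a, 'b) pre_digraph \<Rightarrow> bool" where
  "acyclic_digraph D \<longleftrightarrow> \<not> (\<exists>c. pre_digraph.cycle D c)"

definition feedback_arc_set :: "('a, 'b) pre_digraph \<Rightarrow> 'b set \<Rightarrow> bool" where
  "feedback_arc_set D F \<longleftrightarrow>
     F \<subseteq> arcs D \<and> acyclic_digraph (D\<lparr>arcs := arcs D - F\<rparr>)"

definition fas :: "('a, 'b) pre_digraph \<Rightarrow> nat" where
  "fas D = Min (card ` {F. feedback_arc_set D F})"

text \<open>
  The parts of a partition are nonempty. For a digraph containing a directed cycle this is no
  restriction, since then every feedback arc set is nonempty.
\<close>

definition fasd :: "('a, 'b) pre_digraph \<Rightarrow> nat" where
  "fasd D = Max (card ` {P. partition_on (arcs D) P \<and> (\<forall>F \<in> P. feedback_arc_set D F)})"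

text \<open>The minimum and the maximum above are taken over finite nonempty sets.\<close>

lemma feedback_arc_set_arcs: "feedback_arc_set D (arcs D)"
proof -
  have "\<not> pre_digraph.cycle (D\<lparr>arcs := {}\<rparr>) c" for c
    by (auto simp: pre_digraph.cycle_def pre_digraph.awalk_def)
  then show ?thesis
    by (simp add: feedback_arc_set_def acyclic_digraph_def)
qed

lemma fas_candidates:
  assumes "finite (arcs D)"
  shows "finite {F. feedback_arc_set D F}" "{F. feedback_arc_set D F} \<noteq> {}"
proof -
  show "finite {F. feedback_arc_set D F}"
    by (rule finite_subset[of _ "Pow (arcs D)"]) (use assms in \<open>auto simp: feedback_arc_set_def\<close>)
  show "{F. feedback_arc_set D F} \<noteq> {}"
    using feedback_arc_set_arcs by blast
qed

lemma fasd_candidates: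
  assumes "finite (arcs D)"
  shows "finite {P. partition_on (arcs D) P \<and> (\<forall>F \<in> P. feedback_arc_set D F)}"
    and "{P. partition_on (arcs D) P \<and> (\<forall>F \<in> P. feedback_arc_set D F)} \<noteq> {}"
proof -
  show "finite {P. partition_on (arcs D) P \<and> (\<forall>F \<in> P. feedback_arc_set D F)}"
    by (rule finite_subset[of _ "Pow (Pow (arcs D))"])
      (use assms in \<open>auto simp: feedback_arc_set_def\<close>)
  have "partition_on (arcs D) ({arcs D} - {{}})"
    by (auto simp: partition_on_def disjoint_def)
  then show "{P. partition_on (arcs D) P \<and> (\<forall>F \<in> P. feedback_arc_set D F)} \<noteq> {}"
    using feedback_arc_set_arcs by blast
qed

end

theory Submission
  imports Defs
begin

text \<open>
  Put \<open>d = (p + 1) / 2\<close>, so that the constant is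
  \<open>\<epsilon> = (2 d - 2 sqrt (2 d - 1)) / (8 d)\<close>. Deleting a feedback arc set leaves an
  acyclic digraph; if \<open>A\<close> is the first half of the vertices in a topological order of it, all arcs
  from the complement of \<open>A\<close> to \<open>A\<close> were deleted. It therefore suffices to find a \<open>d\<close>-regular
  digraph without short directed cycles in which every such directed bisection has at least the
  fraction \<open>\<epsilon>\<close> of all arcs. No Ramanujan graph is needed: only \<^emph>\<open>directed\<close> girth matters, and
  random digraphs have sufficiently large bisections.

  In the configuration model a \<open>d\<close>-regular digraph on \<open>n = 2 m\<close> vertices is a permutation of
  \<open>N = d n\<close> half-arcs. By a Chernoff bound, the proportion of permutations with a bisection of size
  at most \<open>\<epsilon> N + O(1)\<close> is at most \<open>4 ^ m exp (- 2 m + m / d)\<close> up to a polynomial factor,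
  which is exponentially small. On the other hand, matching the half-arcs greedily while avoiding
  multiple arcs and cycles shorter than \<open>g\<close> excludes only a bounded number \<open>D\<close> of choices in each
  step, so at least \<open>(N - D)!\<close> partial matchings of the first \<open>N - D\<close> half-arcs have no short
  cycle. This is a polynomial proportion, so one of them has only large bisections. Each of the \<open>D\<close>
  missing arcs is then inserted by a switch with a distant arc, which changes every bisection by
  \<open>O(1)\<close>.
\<close>

section \<open>Digraphs without short cycles\<close>

text \<open>Closed walks stand in for cycles: a closed walk contains a cycle of at most its length,
  so forbidding short ones amounts to the same, and relational powers can be used without tracking
  distinctness of vertices.\<close>

definition short_cycle_free :: "nat \<Rightarrow> 'a rel \<Rightarrow> bool" where
  "short_cycle_free g E \<longleftrightarrow> (\<forall>l x. 0 < l \<longrightarrow> l < g \<longrightarrow> (x, x) \<notin> E ^^ l)"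

lemma relpow_mono:
  fixes R S :: "'a rel"
  assumes "R \<subseteq> S"
  shows "R ^^ l \<subseteq> S ^^ l"
  by (induction l) (use assms in \<open>auto simp: relcomp_unfold\<close>)

lemma short_cycle_free_subset:
  "short_cycle_free g E \<Longrightarrow> E' \<subseteq> E \<Longrightarrow> short_cycle_free g E'"
  unfolding short_cycle_free_def using relpow_mono by blast

text \<open>Keep the part of the walk before the first use of the new arc and the part after its
  last use. Whatever lies between is dropped, hence only an inequality for
  \<open>i + j\<close>.\<close>

lemma relpow_insert:
  assumes "(a, b) \<in> (insert (u, y) E) ^^ l"
  shows "(a, b) \<in> E ^^ l \<or> (\<exists>i j. i + j < l \<and> (a, u) \<in> E ^^ i \<and> (y, b) \<in> E ^^ j)"
  using assms
proof (induction l arbitrary: b)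
  case 0
  then show ?case by simp
next
  case (Suc l)
  from Suc.prems obtain c where ac: "(a, c) \<in> (insert (u, y) E) ^^ l" and cb: "(c, b) \<in> insert (u, y) E"
    by auto
  from Suc.IH[OF ac] consider "(a, c) \<in> E ^^ l"
    | i j where "i + j < l" "(a, u) \<in> E ^^ i" "(y, c) \<in> E ^^ j" by blast
  then show ?case
  proof cases
    case 1
    show ?thesis
    proof (cases "(c, b) \<in> E")
      case True
      with 1 show ?thesis by auto
    next
      case False
      with cb 1 have "l + 0 < Suc l \<and> (a, u) \<in> E ^^ l \<and> (y, b) \<in> E ^^ 0" by simp
      then show ?thesis by blast
    qed
  next
    case 2
    show ?thesis
    proof (cases "(c, b) \<in> E")
      case True
      with 2 have "i + Suc j < Suc l \<and> (a, u) \<in> E ^^ i \<and> (y, b) \<in> E ^^ Suc j" by auto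
      then show ?thesis by blast
    next
      case False
      with cb 2 have "i + 0 < Suc l \<and> (a, u) \<in> E ^^ i \<and> (y, b) \<in> E ^^ 0" by simp
      then show ?thesis by blast
    qed
  qed
qed

text \<open>A short closed walk at \<open>x\<close> through the new arc leaves pieces from
  \<open>x\<close> to \<open>u\<close> and from \<open>y\<close> to \<open>x\<close> in
  \<open>E\<close>. Joined at \<open>x\<close>, they form a walk from \<open>y\<close> to
  \<open>u\<close> that the second assumption forbids.\<close>

lemma short_cycle_free_insert:
  assumes "short_cycle_free g E" and "\<And>l. Suc l < g \<Longrightarrow> (y, u) \<notin> E ^^ l"
  shows "short_cycle_free g (insert (u, y) E)"
  unfolding short_cycle_free_def
proof (intro allI impI notI)
  fix l x
  assume l: "0 < l" "l < g" and "(x, x) \<in> insert (u, y) E ^^ l"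
  moreover have "(x, x) \<notin> E ^^ l" using assms(1) l by (simp add: short_cycle_free_def)
  ultimately obtain i j where ij: "i + j < l" "(x, u) \<in> E ^^ i" "(y, x) \<in> E ^^ j"
    using relpow_insert by meson
  then have "(y, u) \<in> E ^^ (j + i)" by (blast intro: relpow_trans)
  moreover have "Suc (j + i) < g" using ij l by simp
  ultimately show False using assms(2) by blast
qed


section \<open>Degree bounds, balls and conflicts\<close>

definition degrees_le :: "nat \<Rightarrow> 'a rel \<Rightarrow> bool" where
  "degrees_le d E \<longleftrightarrow> (\<forall>v. card (E `` {v}) \<le> d \<and> card (E\<inverse> `` {v}) \<le> d)"

lemma degrees_le_converse: "degrees_le d E \<Longrightarrow> degrees_le d (E\<inverse>)"
  by (simp add: degrees_le_def)

lemma card_Image_le: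
  assumes "finite W" and "degrees_le d E"
  shows "card (E `` W) \<le> d * card W"
proof -
  have "E `` W = (\<Union>v\<in>W. E `` {v})" by auto
  then have "card (E `` W) \<le> (\<Sum>v\<in>W. card (E `` {v}))"
    using card_UN_le[OF assms(1)] by metis
  also have "\<dots> \<le> (\<Sum>v\<in>W. d)"
    using assms(2) by (intro sum_mono) (simp add: degrees_le_def)
  finally show ?thesis by (simp add: mult.commute)
qed

lemma card_arcs_from_eq:
  assumes "finite E" and "finite W"
  shows "card {e \<in> E. fst e \<in> W} = (\<Sum>v\<in>W. card (E `` {v}))"
proof -
  have "{e \<in> E. fst e \<in> W} = (SIGMA v:W. E `` {v})" by auto
  moreover have "finite (E `` {v})" for v using assms(1) by (rule finite_Image)
  ultimately show ?thesis using assms(2) by (simp add: card_SigmaI)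
qed

lemma card_arcs_from_le:
  assumes "finite E" and "finite W" and "degrees_le d E"
  shows "card {e \<in> E. fst e \<in> W} \<le> d * card W"
proof -
  have "card {e \<in> E. fst e \<in> W} \<le> (\<Sum>v\<in>W. d)"
    unfolding card_arcs_from_eq[OF assms(1,2)]
    using assms(3) by (intro sum_mono) (simp add: degrees_le_def)
  then show ?thesis by (simp add: mult.commute)
qed

lemma card_arcs_to_le:
  assumes "finite E" and "finite W" and "degrees_le d E"
  shows "card {e \<in> E. snd e \<in> W} \<le> d * card W"
proof -
  have "card {e \<in> E. snd e \<in> W} = card (prod.swap ` {e \<in> E. snd e \<in> W})"
    by (simp add: card_image)
  also have "prod.swap ` {e \<in> E. snd e \<in> W} = {e \<in> E\<inverse>. fst e \<in> W}"
    by (auto simp: image_iff)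
  also have "card \<dots> \<le> d * card W"
    using assms by (intro card_arcs_from_le) (auto simp: degrees_le_converse)
  finally show ?thesis .
qed

lemma relpow_converse:
  fixes E :: "'a rel"
  shows "(E\<inverse>) ^^ l = (E ^^ l)\<inverse>"
proof (induction l)
  case (Suc l)
  then show ?case by (metis converse_relcomp relpow.simps(2) relpow_commute)
qed auto

definition out_ball :: "nat \<Rightarrow> 'a rel \<Rightarrow> 'a \<Rightarrow> 'a set" where
  "out_ball g E v = (\<Union>l<g. (E ^^ l) `` {v})"

lemma
  assumes "finite E" and "degrees_le d E"
  shows finite_out_ball: "finite (out_ball g E v)"
    and card_out_ball_le: "card (out_ball g E v) \<le> (\<Sum>l<g. d ^ l)"
proof -
  have l: "finite ((E ^^ l) `` {v}) \<and> card ((E ^^ l) `` {v}) \<le> d ^ l" for l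
  proof (induction l)
    case (Suc l)
    have eq: "(E ^^ Suc l) `` {v} = E `` ((E ^^ l) `` {v})" by auto
    have "card (E `` ((E ^^ l) `` {v})) \<le> d * card ((E ^^ l) `` {v})"
      using Suc assms by (intro card_Image_le) auto
    also have "\<dots> \<le> d * d ^ l" using Suc by simp
    finally show ?case unfolding eq using assms(1) by (simp add: finite_Image)
  qed auto
  then show "finite (out_ball g E v)" by (simp add: out_ball_def)
  have "card (out_ball g E v) \<le> (\<Sum>l<g. card ((E ^^ l) `` {v}))"
    unfolding out_ball_def by (rule card_UN_le) simp
  also have "\<dots> \<le> (\<Sum>l<g. d ^ l)" using l by (intro sum_mono) simp
  finally show "card (out_ball g E v) \<le> (\<Sum>l<g. d ^ l)" .
qed

text \<open>The heads \<open>y\<close> for which a new arc \<open>u \<rightarrow> y\<close> might close a short cycle or duplicate an arc.\<close>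

definition conflicts :: "nat \<Rightarrow> 'a rel \<Rightarrow> 'a \<Rightarrow> 'a set" where
  "conflicts g E u = out_ball g (E\<inverse>) u \<union> E `` {u}"

definition conflict_bound :: "nat \<Rightarrow> nat \<Rightarrow> nat" where
  "conflict_bound g d = (\<Sum>l<g. d ^ l) + d"

lemma
  assumes "finite E" and "degrees_le d E"
  shows finite_conflicts: "finite (conflicts g E u)"
    and card_conflicts_le: "card (conflicts g E u) \<le> conflict_bound g d"
proof -
  have f: "finite (E\<inverse>)" "degrees_le d (E\<inverse>)" using assms by (auto simp: degrees_le_converse)
  show "finite (conflicts g E u)"
    using finite_out_ball[OF f] assms(1) by (simp add: conflicts_def finite_Image)
  have "card (conflicts g E u) \<le> card (out_ball g (E\<inverse>) u) + card (E `` {u})"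
    unfolding conflicts_def by (rule card_Un_le)
  also have "\<dots> \<le> conflict_bound g d"
    using card_out_ball_le[OF f] assms(2)
    unfolding conflict_bound_def degrees_le_def by (intro add_mono) blast+
  finally show "card (conflicts g E u) \<le> conflict_bound g d" .
qed

lemma short_cycle_free_insert_nonconflict:
  assumes "short_cycle_free g E" and "y \<notin> conflicts g E u"
  shows "short_cycle_free g (insert (u, y) E)"
  using assms
  by (intro short_cycle_free_insert)
     (auto simp: conflicts_def out_ball_def relpow_converse)

text \<open>
  Raises the out-degree of \<open>u\<close> and the in-degree of \<open>v\<close> by one, keeping all other degrees. An arc
  \<open>u \<rightarrow> v\<close> could close a short cycle, so a far away arc \<open>x \<rightarrow> y\<close> is rerouted instead.
\<close>

lemma switch_arc:
  assumes fin: "finite E" and scf: "short_cycle_free g E" and deg: "degrees_le d E"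
    and u: "card (E `` {u}) < d" and v: "card (E\<inverse> `` {v}) < d"
    and big: "2 * (d * conflict_bound g d) < card E"
  obtains x y where "(x, y) \<in> E" "(u, y) \<notin> E" "(x, v) \<notin> E" "x \<noteq> u" "y \<noteq> v"
    and "short_cycle_free g (insert (x, v) (insert (u, y) (E - {(x, y)})))"
    and "degrees_le d (insert (x, v) (insert (u, y) (E - {(x, y)})))"
proof -
  have f: "finite (E\<inverse>)" "degrees_le d (E\<inverse>)" using fin deg by (auto simp: degrees_le_converse)
  let ?Y = "conflicts g E u" and ?X = "conflicts g (E\<inverse>) v"
  \<comment> \<open>An arc is unusable for the switch if its head conflicts with \<open>u\<close> or
    its tail conflicts with \<open>v\<close>. Bounded degrees allow at most
    \<open>d * conflict_bound g d\<close> arcs of each sort, fewer than \<open>card E\<close>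
    together.\<close>
  have "card ({e \<in> E. snd e \<in> ?Y} \<union> {e \<in> E. fst e \<in> ?X})
      \<le> card {e \<in> E. snd e \<in> ?Y} + card {e \<in> E. fst e \<in> ?X}"
    by (rule card_Un_le)
  also have "\<dots> \<le> d * card ?Y + d * card ?X"
    using fin deg f by (intro add_mono card_arcs_to_le card_arcs_from_le finite_conflicts)
  also have "\<dots> \<le> d * conflict_bound g d + d * conflict_bound g d"
    using fin deg f by (intro add_mono mult_left_mono card_conflicts_le) auto
  also have "\<dots> < card E" using big by simp
  finally have "{e \<in> E. snd e \<in> ?Y} \<union> {e \<in> E. fst e \<in> ?X} \<noteq> E" by auto
  then obtain e where "e \<in> E" "snd e \<notin> ?Y" "fst e \<notin> ?X" by blast
  then obtain x y where xy: "(x, y) \<in> E" "y \<notin> ?Y" "x \<notin> ?X" by (cases e) auto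
  have uy: "(u, y) \<notin> E" and xv: "(x, v) \<notin> E"
    using xy(2,3) by (auto simp: conflicts_def)
  have ne: "x \<noteq> u" "y \<noteq> v" using xy(1) uy xv by auto
  define E0 where "E0 = E - {(x, y)}"
  have sub: "E0 ^^ l \<subseteq> E ^^ l" for l by (rule relpow_mono) (auto simp: E0_def)
  have "short_cycle_free g E0" using scf by (rule short_cycle_free_subset) (auto simp: E0_def)
  then have s1: "short_cycle_free g (insert (u, y) E0)"
  proof (rule short_cycle_free_insert)
    fix l assume "Suc l < g"
    then have "(y, u) \<notin> E ^^ l" using xy(2) by (auto simp: conflicts_def out_ball_def relpow_converse)
    then show "(y, u) \<notin> E0 ^^ l" using sub by blast
  qed
  have s2: "short_cycle_free g (insert (x, v) (insert (u, y) E0))"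
  proof (rule short_cycle_free_insert[OF s1], rule notI)
    fix l assume l: "Suc l < g" and "(v, x) \<in> insert (u, y) E0 ^^ l"
    then consider "(v, x) \<in> E0 ^^ l" | i j where "i + j < l" "(y, x) \<in> E0 ^^ j"
      using relpow_insert by meson
    then show False
    proof cases
      case 1
      then have "(v, x) \<in> E ^^ l" using sub by blast
      then show False using xy(3) l by (auto simp: conflicts_def out_ball_def)
    next
      case 2
      \<comment> \<open>A walk using \<open>u -> y\<close> ends with a walk from \<open>y\<close> to
        \<open>x\<close>. The removed arc \<open>x -> y\<close> would have closed it to a short
        cycle already in \<open>E\<close>.\<close>
      then have "(y, x) \<in> E ^^ j" using sub by blast
      then have "(y, y) \<in> E ^^ Suc j" using xy(1) by auto
      moreover have "Suc j < g" using l 2 by simp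
      ultimately show False using scf unfolding short_cycle_free_def by blast
    qed
  qed
  have fo: "finite (E `` {w})" and fi: "finite (E\<inverse> `` {w})" for w
    using fin f by (auto intro: finite_Image)
  have d3: "degrees_le d (insert (x, v) (insert (u, y) E0))" (is "degrees_le d ?E")
    unfolding degrees_le_def
  proof (intro allI conjI)
    fix w
    show "card (?E `` {w}) \<le> d"
    proof -
      consider "w = u" | "w = x" | "w \<noteq> u" "w \<noteq> x" by blast
      then show ?thesis
      proof cases
        case 1
        then have "?E `` {w} = insert y (E `` {u})" using ne by (auto simp: E0_def)
        then show ?thesis using u uy fo by (simp add: card_insert_if)
      next
        case 2
        \<comment> \<open>The vertex \<open>x\<close> exchanges its out-neighbour \<open>y\<close>
          for \<open>v\<close>, so its out-degree is unchanged.\<close>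
        then have "?E `` {w} = insert v (E `` {x} - {y})" using ne by (auto simp: E0_def)
        moreover have "v \<notin> E `` {x} - {y}" "y \<in> E `` {x}" using xy(1) xv by auto
        ultimately have "card (?E `` {w}) = card (E `` {x})"
          using fo by (metis card.remove card_insert_disjoint finite_Diff)
        then show ?thesis using deg by (simp add: degrees_le_def)
      next
        case 3
        then have "?E `` {w} = E `` {w}" by (auto simp: E0_def)
        then show ?thesis using deg by (simp add: degrees_le_def)
      qed
    qed
    show "card (?E\<inverse> `` {w}) \<le> d"
    proof -
      consider "w = v" | "w = y" | "w \<noteq> v" "w \<noteq> y" by blast
      then show ?thesis
      proof cases
        case 1
        then have "?E\<inverse> `` {w} = insert x (E\<inverse> `` {v})" using ne by (auto simp: E0_def)
        then show ?thesis using v xv fi by (simp add: card_insert_if)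
      next
        case 2
        then have "?E\<inverse> `` {w} = insert u (E\<inverse> `` {y} - {x})" using ne by (auto simp: E0_def)
        moreover have "u \<notin> E\<inverse> `` {y} - {x}" "x \<in> E\<inverse> `` {y}" using xy(1) uy by auto
        ultimately have "card (?E\<inverse> `` {w}) = card (E\<inverse> `` {y})"
          using fi by (metis card.remove card_insert_disjoint finite_Diff)
        then show ?thesis using deg by (simp add: degrees_le_def)
      next
        case 3
        then have "?E\<inverse> `` {w} = E\<inverse> `` {w}" by (auto simp: E0_def)
        then show ?thesis using deg by (simp add: degrees_le_def)
      qed
    qed
  qed
  show thesis using that[OF xy(1) uy xv ne] s2 d3 unfolding E0_def by blast
qed

section \<open>Completion to a regular digraph\<close>

lemma exists_small_degree:
  assumes "finite V" and "E \<subseteq> V \<times> V" and "card E < d * card V"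
  shows "\<exists>u\<in>V. card (E `` {u}) < d"
proof (rule ccontr)
  assume "\<not> ?thesis"
  then have "(\<Sum>v\<in>V. d) \<le> (\<Sum>v\<in>V. card (E `` {v}))"
    by (intro sum_mono) (simp add: not_less)
  also have "\<dots> = card {e \<in> E. fst e \<in> V}"
    using assms(1) finite_subset[OF assms(2)] by (simp add: card_arcs_from_eq)
  also have "{e \<in> E. fst e \<in> V} = E" using assms(2) by auto
  finally show False using assms(3) by (simp add: mult.commute)
qed

text \<open>The out-degrees sum to \<open>card E\<close>, the largest value that the bound
  \<open>d\<close> permits, so no vertex can fall below \<open>d\<close>.\<close>

lemma degree_eq_if_card_eq:
  assumes "finite V" and "E \<subseteq> V \<times> V" and "degrees_le d E" and "card E = d * card V" and "v \<in> V"
  shows "card (E `` {v}) = d"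
proof (rule ccontr)
  assume "card (E `` {v}) \<noteq> d"
  then have "card (E `` {v}) < d" using assms(3) by (metis degrees_le_def le_neq_implies_less)
  then have "(\<Sum>v\<in>V. card (E `` {v})) < (\<Sum>v\<in>V. d)"
    using assms by (intro sum_strict_mono_ex1) (auto simp: degrees_le_def)
  moreover have "(\<Sum>v\<in>V. card (E `` {v})) = card {e \<in> E. fst e \<in> V}"
    using assms(1) finite_subset[OF assms(2)] by (simp add: card_arcs_from_eq)
  moreover have "{e \<in> E. fst e \<in> V} = E" using assms(2) by auto
  ultimately show False using assms(4) by (simp add: mult.commute)
qed

text \<open>Induction on the number \<open>r\<close> of missing arcs. A switch at a vertex
  \<open>u\<close> lacking an out-arc and a vertex \<open>v\<close> lacking an in-arc gains one arc
  in total. It destroys a single old arc, which is why at most \<open>r\<close> arcs of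
  \<open>E\<close> are lost.\<close>

lemma regular_completion:
  assumes "finite V" and "E \<subseteq> V \<times> V" and "short_cycle_free g E" and "degrees_le d E"
    and "card E + r = d * card V" and "2 * (d * conflict_bound g d) < card E"
  obtains E' where "E' \<subseteq> V \<times> V" and "short_cycle_free g E'" and "degrees_le d E'"
    and "card E' = d * card V" and "card (E - E') \<le> r"
  using assms(2-)
proof (induction r arbitrary: E thesis)
  case 0
  show ?case by (rule 0(1)[of E]) (use 0 in auto)
next
  case (Suc r)
  have fin: "finite E" using Suc.prems(2) assms(1) by (meson finite_SigmaI finite_subset)
  have "\<exists>u\<in>V. card (E `` {u}) < d"
    using Suc.prems assms(1) by (intro exists_small_degree) auto
  then obtain u where u: "u \<in> V" "card (E `` {u}) < d" by blast
  have "\<exists>v\<in>V. card (E\<inverse> `` {v}) < d"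
    using Suc.prems assms(1) by (intro exists_small_degree) auto
  then obtain v where v: "v \<in> V" "card (E\<inverse> `` {v}) < d" by blast
  obtain x y where xy: "(x, y) \<in> E" "(u, y) \<notin> E" "(x, v) \<notin> E" "x \<noteq> u" "y \<noteq> v"
    and s: "short_cycle_free g (insert (x, v) (insert (u, y) (E - {(x, y)})))"
    and dg: "degrees_le d (insert (x, v) (insert (u, y) (E - {(x, y)})))"
    using switch_arc[OF fin Suc.prems(3,4) u(2) v(2) Suc.prems(6)] by metis
  let ?E = "insert (x, v) (insert (u, y) (E - {(x, y)}))"
  have "card E > 0" using Suc.prems(6) by simp
  then have card: "card ?E = Suc (card E)"
    using xy fin by (simp add: card_insert_if card_Diff_singleton_if)
  have sub: "?E \<subseteq> V \<times> V" using Suc.prems(2) xy u v by auto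
  obtain E' where E': "E' \<subseteq> V \<times> V" "short_cycle_free g E'" "degrees_le d E'"
    "card E' = d * card V" "card (?E - E') \<le> r"
    by (rule Suc.IH[OF _ sub s dg]) (use Suc.prems card in auto)
  \<comment> \<open>An arc of \<open>E\<close> missing at the end was either rerouted now or lost in
    a later switch.\<close>
  have "E - E' \<subseteq> insert (x, y) (?E - E')" by auto
  then have "card (E - E') \<le> card (insert (x, y) (?E - E'))"
    using fin by (intro card_mono) auto
  also have "\<dots> \<le> Suc r" using E'(5) fin by (auto simp: card_insert_if)
  finally show ?case using Suc.prems(1) E' by blast
qed

section \<open>Counting pairings without short cycles\<close>

text \<open>
  Each vertex \<open>v\<close> owns the out- and the in-half-arcs \<open>j\<close> with \<open>j div d = v\<close>; a pairing \<open>f\<close> joins the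
  out-half-arc \<open>i\<close> to the in-half-arc \<open>f i\<close>.
\<close>

definition half_arc :: "nat \<Rightarrow> (nat \<Rightarrow> nat) \<Rightarrow> nat \<Rightarrow> nat \<times> nat" where
  "half_arc d f i = (i div d, f i div d)"

text \<open>The functions are extensional, so each injection on \<open>A\<close> is counted exactly
  once.\<close>

definition injections :: "'a set \<Rightarrow> 'b set \<Rightarrow> ('a \<Rightarrow> 'b) set" where
  "injections A B = {f \<in> A \<rightarrow>\<^sub>E B. inj_on f A}"

text \<open>Injectivity of \<open>half_arc d f\<close> excludes multiple arcs, which the image set
  alone would silently merge.\<close>

definition good_pairings :: "nat \<Rightarrow> nat \<Rightarrow> nat \<Rightarrow> nat \<Rightarrow> (nat \<Rightarrow> nat) set" where
  "good_pairings d g N k =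
     {f \<in> injections {..<k} {..<N}. inj_on (half_arc d f) {..<k} \<and>
        short_cycle_free g (half_arc d f ` {..<k})}"

lemma finite_injections: "finite A \<Longrightarrow> finite B \<Longrightarrow> finite (injections A B)"
  unfolding injections_def by (rule finite_subset[of _ "A \<rightarrow>\<^sub>E B"]) (auto intro: finite_PiE)

lemma div_fiber_eq:
  fixes d v :: nat
  assumes "d > 0"
  shows "{j. j div d = v} = {v * d..<v * d + d}"
proof (intro set_eqI iffI)
  fix j assume "j \<in> {j. j div d = v}"
  then show "j \<in> {v * d..<v * d + d}"
    using assms div_times_less_eq_dividend[of j d] dividend_less_div_times[of d j] by auto
next
  fix j assume "j \<in> {v * d..<v * d + d}"
  then show "j \<in> {j. j div d = v}" by (simp add: div_nat_eqI mult.commute)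
qed

lemma
  fixes d :: nat
  assumes "d > 0" and "finite W"
  shows finite_div_vimage: "finite {j. j div d \<in> W}"
    and card_div_vimage: "card {j. j div d \<in> W} = d * card W"
proof -
  have eq: "{j. j div d \<in> W} = (\<Union>v\<in>W. {j. j div d = v})" by auto
  have f: "finite {j. j div d = v}" "card {j. j div d = v} = d" for v
    using assms(1) by (simp_all add: div_fiber_eq)
  show "finite {j. j div d \<in> W}" unfolding eq using assms(2) f by blast
  have "card {j. j div d \<in> W} = (\<Sum>v\<in>W. card {j. j div d = v})"
    unfolding eq using assms(2) f by (intro card_UN_disjoint) auto
  then show "card {j. j div d \<in> W} = d * card W" using f by (simp add: mult.commute)
qed

text \<open>A vertex owns \<open>d\<close> half-arcs of each kind, and injectivity of
  \<open>f\<close> lets each in-half-arc be used only once.\<close>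

lemma degrees_le_half_arcs:
  assumes "d > 0" and "inj_on f {..<k}"
  shows "degrees_le d (half_arc d f ` {..<k})"
  unfolding degrees_le_def
proof (intro allI conjI)
  fix v
  let ?E = "half_arc d f ` {..<k}"
  have fib: "finite {j. j div d = v}" "card {j. j div d = v} = d"
    using assms(1) by (simp_all add: div_fiber_eq)
  have "?E `` {v} \<subseteq> (\<lambda>i. f i div d) ` {j. j div d = v}"
    by (auto simp: half_arc_def)
  then show "card (?E `` {v}) \<le> d"
    using fib by (metis surj_card_le)
  have "?E\<inverse> `` {v} \<subseteq> (\<lambda>i. i div d) ` {i. i < k \<and> f i div d = v}"
    by (auto simp: half_arc_def)
  then have "card (?E\<inverse> `` {v}) \<le> card {i. i < k \<and> f i div d = v}"
    by (intro surj_card_le) auto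
  also have "\<dots> = card (f ` {i. i < k \<and> f i div d = v})"
    using assms(2) by (intro card_image[symmetric]) (auto simp: inj_on_def)
  also have "\<dots> \<le> card {j. j div d = v}" using fib(1) by (intro card_mono) auto
  finally show "card (?E\<inverse> `` {v}) \<le> d" using fib(2) by simp
qed

lemma good_pairings_extend:
  assumes f: "f \<in> good_pairings d g N k"
    and y: "y < N" "y \<notin> f ` {..<k}" "y div d \<notin> conflicts g (half_arc d f ` {..<k}) (k div d)"
  shows "f(k := y) \<in> good_pairings d g N (Suc k)"
proof -
  have eq: "half_arc d (f(k := y)) i = half_arc d f i" if "i \<in> {..<k}" for i
    using that by (simp add: half_arc_def)
  have new: "half_arc d (f(k := y)) k = (k div d, y div d)" by (simp add: half_arc_def)
  have im: "half_arc d (f(k := y)) ` {..<k} = half_arc d f ` {..<k}"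
    using eq by (intro image_cong) auto
  have fE: "f \<in> {..<k} \<rightarrow>\<^sub>E {..<N}" and finj: "inj_on f {..<k}"
    and ginj: "inj_on (half_arc d f) {..<k}" and scf: "short_cycle_free g (half_arc d f ` {..<k})"
    using f by (auto simp: good_pairings_def injections_def)
  have "f(k := y) \<in> {..<Suc k} \<rightarrow>\<^sub>E {..<N}"
    using fE y(1) by (auto simp: PiE_iff extensional_def)
  moreover have "inj_on (f(k := y)) {..<Suc k}"
    unfolding lessThan_Suc by (rule inj_onI) (use finj y(2) in \<open>auto simp: inj_on_eq_iff split: if_splits\<close>)
  moreover have "inj_on (half_arc d (f(k := y))) {..<Suc k}"
  proof -
    have "inj_on (half_arc d (f(k := y))) {..<k} \<longleftrightarrow> inj_on (half_arc d f) {..<k}"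
      by (rule inj_on_cong) (rule eq)
    then have "inj_on (half_arc d (f(k := y))) {..<k}" using ginj by blast
    moreover have "(k div d, y div d) \<notin> half_arc d f ` {..<k}"
      using y(3) by (auto simp: conflicts_def)
    ultimately show ?thesis
      unfolding lessThan_Suc inj_on_insert new by (auto simp: im)
  qed
  moreover have "short_cycle_free g (half_arc d (f(k := y)) ` {..<Suc k})"
    using short_cycle_free_insert_nonconflict[OF scf y(3)]
    unfolding lessThan_Suc image_insert im new .
  ultimately show ?thesis by (simp add: good_pairings_def injections_def)
qed

text \<open>One greedy step: of the \<open>N\<close> in-half-arcs, \<open>k\<close> are taken and at
  most \<open>d * conflict_bound g d\<close> belong to vertices in conflict with the tail of the new
  arc. All others extend the pairing.\<close>

lemma card_good_pairings_Suc:
  assumes "d > 0"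
  shows "card (good_pairings d g N k) * (N - k - d * conflict_bound g d)
      \<le> card (good_pairings d g N (Suc k))"
proof -
  let ?G = "good_pairings d g N k"
  define Y where "Y f = {y. y < N \<and> y \<notin> f ` {..<k} \<and>
      y div d \<notin> conflicts g (half_arc d f ` {..<k}) (k div d)}" for f
  have fin: "finite (good_pairings d g N k)" for k
    by (rule finite_subset[OF _ finite_injections[of "{..<k}" "{..<N}"]])
       (auto simp: good_pairings_def)
  have finY: "finite (Y f)" for f by (simp add: Y_def)
  have cardY: "N - k - d * conflict_bound g d \<le> card (Y f)" if "f \<in> ?G" for f
  proof -
    let ?C = "conflicts g (half_arc d f ` {..<k}) (k div d)"
    have inj: "inj_on f {..<k}" using that by (simp add: good_pairings_def injections_def)
    note deg = degrees_le_half_arcs[OF assms inj]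
    have C: "finite ?C" "card ?C \<le> conflict_bound g d"
      using deg by (auto intro: finite_conflicts card_conflicts_le)
    have "{..<N} - f ` {..<k} - {j. j div d \<in> ?C} \<subseteq> Y f" by (auto simp: Y_def)
    then have "card ({..<N} - f ` {..<k} - {j. j div d \<in> ?C}) \<le> card (Y f)"
      using finY by (rule card_mono[rotated])
    moreover have "card ({..<N} - f ` {..<k}) - card {j. j div d \<in> ?C}
        \<le> card ({..<N} - f ` {..<k} - {j. j div d \<in> ?C})"
      using finite_div_vimage[OF assms C(1)] by (rule diff_card_le_card_Diff)
    moreover have "card {..<N} - card (f ` {..<k}) \<le> card ({..<N} - f ` {..<k})"
      by (intro diff_card_le_card_Diff) auto
    moreover have "card (f ` {..<k}) \<le> k" using card_image_le[of "{..<k}" f] by simp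
    moreover have "card {j. j div d \<in> ?C} \<le> d * conflict_bound g d"
      using card_div_vimage[OF assms C(1)] C(2) by simp
    ultimately show ?thesis by simp
  qed
  have "card ?G * (N - k - d * conflict_bound g d) = (\<Sum>f\<in>?G. N - k - d * conflict_bound g d)"
    by simp
  also have "\<dots> \<le> (\<Sum>f\<in>?G. card (Y f))" using cardY by (intro sum_mono)
  also have "\<dots> = card (SIGMA f:?G. Y f)" using fin finY by (simp add: card_SigmaI)
  also have "\<dots> = card ((\<lambda>(f, y). f(k := y)) ` (SIGMA f:?G. Y f))"
  proof (rule card_image[symmetric], rule inj_onI, clarify)
    fix f y f' y'
    assume f: "f \<in> ?G" "f' \<in> ?G" and eq: "f(k := y) = f'(k := y')"
    \<comment> \<open>Both functions have the default value at \<open>k\<close>, so the update can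
      be undone and no extension is counted twice.\<close>
    have "f k = undefined" "f' k = undefined"
      using f by (auto simp: good_pairings_def injections_def PiE_iff extensional_def)
    then show "f = f' \<and> y = y'" using eq by (metis fun_upd_idem_iff fun_upd_same fun_upd_upd)
  qed
  also have "\<dots> \<le> card (good_pairings d g N (Suc k))"
    using fin by (intro card_mono) (auto simp: Y_def intro!: good_pairings_extend)
  finally show ?thesis .
qed

text \<open>The greedy steps offer at least \<open>N - D\<close>, \<open>N - D - 1\<close>, ...
  choices. The induction keeps the factorial of the remaining factors on the right and so avoids
  division.\<close>

lemma card_good_pairings_ge:
  assumes "d > 0"
  shows "fact (N - d * conflict_bound g d)
      \<le> card (good_pairings d g N (N - d * conflict_bound g d))"
proof -
  define D where "D = d * conflict_bound g d"
  have "fact (N - D) \<le> card (good_pairings d g N k) * fact (N - D - k)" if "k \<le> N - D" for k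
    using that
  proof (induction k)
    case 0
    have "(\<lambda>_. undefined) \<in> good_pairings d g N 0"
      by (auto simp: good_pairings_def injections_def short_cycle_free_def relpow_empty)
    moreover have "finite (good_pairings d g N 0)"
      by (rule finite_subset[OF _ finite_injections[of "{..<0}" "{..<N}"]])
         (auto simp: good_pairings_def)
    ultimately have "1 \<le> card (good_pairings d g N 0)"
      by (metis One_nat_def Suc_leI card_gt_0_iff empty_iff)
    then show ?case by simp
  next
    case (Suc k)
    then have "fact (N - D) \<le> card (good_pairings d g N k) * fact (N - D - k)" by simp
    also have "fact (N - D - k) = (N - D - k) * fact (N - D - Suc k)"
      using Suc.prems by (metis Suc_diff_Suc Suc_le_lessD fact_Suc of_nat_id)
    also have "card (good_pairings d g N k) * ((N - D - k) * fact (N - D - Suc k))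
        \<le> card (good_pairings d g N (Suc k)) * fact (N - D - Suc k)"
      using card_good_pairings_Suc[OF assms, of g N k]
      by (simp add: D_def add.commute mult.assoc[symmetric])
    finally show ?case .
  qed
  from this[of "N - D"] show ?thesis by (simp add: D_def)
qed

section \<open>Counting pairings with a small bisection\<close>

lemma card_injections_le:
  assumes "finite A" and "finite B" and "card A = card B"
  shows "card (injections A B) \<le> fact (card B)"
  using assms
proof (induction A arbitrary: B rule: finite_induct)
  case empty
  then show ?case by (simp add: injections_def)
next
  case (insert a A)
  have sub: "injections (insert a A) B
      \<subseteq> (\<lambda>(y, h). h(a := y)) ` (SIGMA y:B. injections A (B - {y}))"
  proof
    fix f assume f: "f \<in> injections (insert a A) B"
    have "f = (restrict f A)(a := f a)"
      using f insert.hyps by (auto simp: injections_def PiE_iff extensional_def fun_eq_iff)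
    moreover have "f a \<in> B" using f by (auto simp: injections_def)
    moreover have "restrict f A \<in> injections A (B - {f a})"
      using f insert.hyps by (auto simp: injections_def inj_on_def PiE_iff)
    ultimately show "f \<in> (\<lambda>(y, h). h(a := y)) ` (SIGMA y:B. injections A (B - {y}))"
      by (intro image_eqI[of _ _ "(f a, restrict f A)"]) auto
  qed
  have fin: "finite (SIGMA y:B. injections A (B - {y}))"
    using insert by (auto intro: finite_injections)
  have "card (injections (insert a A) B) \<le> card (SIGMA y:B. injections A (B - {y}))"
    using sub fin by (rule surj_card_le[rotated])
  also have "\<dots> = (\<Sum>y\<in>B. card (injections A (B - {y})))"
    using insert by (simp add: card_SigmaI finite_injections)
  also have "\<dots> \<le> (\<Sum>y\<in>B. fact (card B - 1))"
  proof (rule sum_mono)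
    fix y assume y: "y \<in> B"
    have "card A = card (B - {y})" using insert y by simp
    then have "card (injections A (B - {y})) \<le> fact (card (B - {y}))"
      using insert by (intro insert.IH) auto
    then show "card (injections A (B - {y})) \<le> fact (card B - 1)" using y insert by simp
  qed
  also have "\<dots> = fact (card B)"
    using insert by (metis card_gt_0_iff fact_num_eq_if insert_not_empty card_eq_0_iff finite_insert sum_constant of_nat_id)
  finally show ?case .
qed

text \<open>The complements of \<open>K\<close> and of the image of \<open>f\<close> have equal
  size, so a bijection between them can be glued to \<open>f\<close>. This turns a partial pairing
  into a permutation.\<close>

lemma injections_extend:
  assumes "finite H" and "K \<subseteq> H" and "f \<in> injections K H"
  obtains h where "h \<in> injections H H" and "restrict h K = f"
proof -
  have f: "inj_on f K" "f ` K \<subseteq> H" "f \<in> extensional K"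
    using assms(3) by (auto simp: injections_def PiE_iff)
  have "card (H - K) = card (H - f ` K)"
    using assms f by (simp add: card_Diff_subset finite_subset card_image)
  then obtain b where b: "bij_betw b (H - K) (H - f ` K)"
    using finite_same_card_bij assms(1) by blast
  define h where "h = (\<lambda>i\<in>H. if i \<in> K then f i else b i)"
  have bH: "b i \<in> H - f ` K" if "i \<in> H - K" for i using b that by (auto simp: bij_betw_def)
  have binj: "inj_on b (H - K)" using b by (simp add: bij_betw_def)
  have "inj_on h H"
  proof (rule inj_onI)
    fix i j assume ij: "i \<in> H" "j \<in> H" "h i = h j"
    consider "i \<in> K" "j \<in> K" | "i \<in> K" "j \<notin> K" | "i \<notin> K" "j \<in> K" | "i \<notin> K" "j \<notin> K" by blast
    then show "i = j"
    proof cases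
      case 1
      then have "f i = f j" using ij by (simp add: h_def)
      then show ?thesis using f(1) 1 by (simp add: inj_on_eq_iff)
    next
      case 2
      then have "b j = f i" using ij by (simp add: h_def)
      then show ?thesis using ij bH[of j] 2 by (metis Diff_iff imageI)
    next
      case 3
      then have "b i = f j" using ij by (simp add: h_def)
      then show ?thesis using ij bH[of i] 3 by (metis Diff_iff imageI)
    next
      case 4
      then have "b i = b j" using ij by (simp add: h_def)
      then show ?thesis using binj ij 4 by (simp add: inj_on_eq_iff)
    qed
  qed
  moreover have "h i \<in> H" if "i \<in> H" for i
    using f(2) bH[of i] that by (auto simp: h_def)
  then have "h \<in> H \<rightarrow>\<^sub>E H" by (simp add: PiE_iff h_def)
  moreover have "restrict h K = f"
  proof
    fix i
    show "restrict h K i = f i"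
      using f(3) assms(2) by (cases "i \<in> K") (auto simp: h_def extensional_def)
  qed
  ultimately show thesis using that[of h] by (simp add: injections_def)
qed

text \<open>Such a permutation sends \<open>A\<close> into \<open>H - S\<close>, so it is determined
  by two injections between sets of size \<open>M\<close>.\<close>

lemma card_injections_image_eq_le:
  assumes "finite H" and "A \<subseteq> H" and "card A = M" and "card (H - A) = M"
    and "S \<subseteq> H" and "card S = M"
  shows "card {f \<in> injections H H. f ` (H - A) = S} \<le> fact M * fact M"
proof -
  let ?F = "{f \<in> injections H H. f ` (H - A) = S}"
  let ?r = "\<lambda>f. (restrict f (H - A), restrict f A)"
  have fin: "finite A" "finite S" "finite (H - A)" "finite (H - S)"
    using assms finite_subset by auto
  have cHS: "card (H - S) = M"
    using assms fin by (metis card_Diff_subset)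
  have "inj_on ?r ?F"
  proof (rule inj_onI)
    fix f h assume fh: "f \<in> ?F" "h \<in> ?F" and eq: "?r f = ?r h"
    show "f = h"
    proof
      fix i
      consider "i \<in> H - A" | "i \<in> A" | "i \<notin> H" by blast
      then show "f i = h i"
      proof cases
        case 1 then show ?thesis using eq by (metis restrict_apply prod.inject)
      next
        case 2 then show ?thesis using eq by (metis restrict_apply prod.inject)
      next
        case 3 then show ?thesis using fh by (auto simp: injections_def PiE_iff extensional_def)
      qed
    qed
  qed
  moreover have "?r ` ?F \<subseteq> injections (H - A) S \<times> injections A (H - S)"
  proof (rule image_subsetI)
    fix f assume f: "f \<in> ?F"
    then have inj: "inj_on f H" and fH: "f ` H \<subseteq> H" and fS: "f ` (H - A) = S"
      by (auto simp: injections_def)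
    have "f i \<notin> S" if i: "i \<in> A" for i
    proof
      assume "f i \<in> S"
      then obtain j where "j \<in> H - A" "f j = f i" using fS by force
      then show False using inj i assms(2) by (metis DiffD1 DiffD2 inj_on_def subsetD)
    qed
    then have "f ` A \<subseteq> H - S" using fH assms(2) by blast
    moreover have "inj_on f A" "inj_on f (H - A)"
      using inj assms(2) by (blast intro: inj_on_subset)+
    ultimately have "restrict f A \<in> injections A (H - S)"
      by (simp add: injections_def inj_on_restrict_eq image_subset_iff)
    moreover have "restrict f (H - A) \<in> injections (H - A) S"
      using \<open>inj_on f (H - A)\<close> fS by (auto simp: injections_def inj_on_restrict_eq)
    ultimately show "?r f \<in> injections (H - A) S \<times> injections A (H - S)" by simp
  qed
  ultimately have "card ?F \<le> card (injections (H - A) S \<times> injections A (H - S))"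
    using fin by (intro card_inj_on_le) (auto intro: finite_injections)
  also have "\<dots> = card (injections (H - A) S) * card (injections A (H - S))"
    by (rule card_cartesian_product)
  also have "\<dots> \<le> fact (card S) * fact (card (H - S))"
    using fin assms cHS by (intro mult_mono card_injections_le) auto
  finally show ?thesis using cHS assms(6) by simp
qed

text \<open>\<open>S\<close> is determined by its \<open>j\<close> elements in \<open>A\<close> and
  its \<open>M - j\<close> elements outside; both choices are counted by the same binomial
  coefficient.\<close>

lemma card_subsets_split_le:
  assumes "finite H" and "A \<subseteq> H" and "card A = M" and "card (H - A) = M"
  shows "card {S. S \<subseteq> H \<and> card S = M \<and> card (S \<inter> A) = j} \<le> (M choose j)\<^sup>2"
proof -
  let ?P = "{X. X \<subseteq> A \<and> card X = j} \<times> {Y. Y \<subseteq> H - A \<and> card Y = M - j}"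
  let ?r = "\<lambda>S. (S \<inter> A, S - A)"
  have fin: "finite A" "finite (H - A)" using assms finite_subset by auto
  have "card {S. S \<subseteq> H \<and> card S = M \<and> card (S \<inter> A) = j} \<le> card ?P"
  proof (rule card_inj_on_le)
    show "inj_on ?r {S. S \<subseteq> H \<and> card S = M \<and> card (S \<inter> A) = j}"
      by (rule inj_onI) (auto simp: set_eq_iff)
    show "?r ` {S. S \<subseteq> H \<and> card S = M \<and> card (S \<inter> A) = j} \<subseteq> ?P"
      using assms(1) by (auto simp: card_Diff_subset_Int finite_subset)
    show "finite ?P" using fin by auto
  qed
  also have "\<dots> = (M choose j) * (M choose (M - j))"
    using assms fin by (simp add: card_cartesian_product n_subsets)
  also have "\<dots> \<le> (M choose j)\<^sup>2"
    by (cases "j \<le> M") (simp_all add: power2_eq_square binomial_symmetric[symmetric])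
  finally show ?thesis .
qed

text \<open>Classify the permutations by the image \<open>S\<close> of \<open>H - A\<close>. By
  injectivity, the number of crossings is \<open>card (S \<inter> A)\<close>.\<close>

lemma card_injections_crossing_eq_le:
  assumes "finite H" and "A \<subseteq> H" and "card A = M" and "card (H - A) = M"
  shows "card {f \<in> injections H H. card {i \<in> H - A. f i \<in> A} = j} \<le> (M choose j)\<^sup>2 * (fact M)\<^sup>2"
proof -
  let ?S = "{S. S \<subseteq> H \<and> card S = M \<and> card (S \<inter> A) = j}"
  have finS: "finite ?S" using assms(1) by (auto intro: finite_subset[of _ "Pow H"])
  have "{f \<in> injections H H. card {i \<in> H - A. f i \<in> A} = j}
      \<subseteq> (\<Union>S\<in>?S. {f \<in> injections H H. f ` (H - A) = S})"
  proof
    fix f assume f: "f \<in> {f \<in> injections H H. card {i \<in> H - A. f i \<in> A} = j}"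
    then have inj: "inj_on f H" and fH: "f ` H \<subseteq> H" by (auto simp: injections_def)
    have "f ` (H - A) \<inter> A = f ` {i \<in> H - A. f i \<in> A}" by auto
    moreover have "card (f ` {i \<in> H - A. f i \<in> A}) = card {i \<in> H - A. f i \<in> A}"
      using inj by (intro card_image) (auto simp: inj_on_def)
    moreover have "card (f ` (H - A)) = M"
      using inj assms(4) by (subst card_image) (auto simp: inj_on_def)
    ultimately have "f ` (H - A) \<in> ?S" using f fH by auto
    then show "f \<in> (\<Union>S\<in>?S. {f \<in> injections H H. f ` (H - A) = S})" using f by auto
  qed
  then have "card {f \<in> injections H H. card {i \<in> H - A. f i \<in> A} = j}
      \<le> card (\<Union>S\<in>?S. {f \<in> injections H H. f ` (H - A) = S})"
    using finS assms(1) by (intro card_mono finite_UN_I) (simp_all add: finite_injections)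
  also have "\<dots> \<le> (\<Sum>S\<in>?S. card {f \<in> injections H H. f ` (H - A) = S})"
    using finS by (rule card_UN_le)
  also have "\<dots> \<le> (\<Sum>S\<in>?S. fact M * fact M)"
    using assms by (intro sum_mono card_injections_image_eq_le) auto
  also have "\<dots> = card ?S * (fact M * fact M)" by simp
  also have "\<dots> \<le> (M choose j)\<^sup>2 * (fact M * fact M)"
    using card_subsets_split_le[OF assms] by (intro mult_right_mono) auto
  finally show ?thesis by (simp add: power2_eq_square)
qed

text \<open>A single term of the binomial expansion of \<open>(1 + s) ^ M\<close> is at most the
  whole sum, and \<open>s ^ T\<close> is at most \<open>s ^ j\<close> because \<open>s\<close> is at
  most 1.\<close>

lemma binomial_le_chernoff:
  fixes s :: real
  assumes "0 < s" "s \<le> 1" "j \<le> T"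
  shows "real (M choose j) \<le> (1 + s) ^ M / s ^ T"
proof (cases "j \<le> M")
  case True
  have "real (M choose j) * s ^ T \<le> real (M choose j) * s ^ j"
    using assms by (intro mult_left_mono power_decreasing) auto
  also have "\<dots> \<le> (\<Sum>k\<le>M. real (M choose k) * s ^ k)"
    using True assms by (intro member_le_sum[where f = "\<lambda>k. real (M choose k) * s ^ k"]) auto
  also have "\<dots> = (1 + s) ^ M"
    using binomial_ring[of s 1 M] by (simp add: add.commute)
  finally show ?thesis using assms by (simp add: field_simps)
next
  case False
  then have "real (M choose j) = 0" by simp
  also have "\<dots> \<le> (1 + s) ^ M / s ^ T" using assms by simp
  finally show ?thesis .
qed

lemma card_injections_crossing_le:
  fixes s :: real
  assumes "finite H" and "A \<subseteq> H" and "card A = M" and "card (H - A) = M"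
    and s: "0 < s" "s \<le> 1"
  shows "real (card {f \<in> injections H H. card {i \<in> H - A. f i \<in> A} \<le> T})
      \<le> (real M + 1) * (fact M)\<^sup>2 * ((1 + s) ^ M / s ^ T)\<^sup>2"
proof -
  let ?F = "\<lambda>j. {f \<in> injections H H. card {i \<in> H - A. f i \<in> A} = j}"
  \<comment> \<open>No more than \<open>M\<close> crossings are possible, so at most
    \<open>M + 1\<close> values of \<open>j\<close> contribute, whatever \<open>T\<close>
    is.\<close>
  let ?J = "{j. j \<le> M \<and> j \<le> T}"
  have finF: "finite (?F j)" for j using assms(1) by (simp add: finite_injections)
  have "card {i \<in> H - A. f i \<in> A} \<le> M" for f
    using card_mono[of "H - A" "{i \<in> H - A. f i \<in> A}"] assms(1,4) by auto
  then have "{f \<in> injections H H. card {i \<in> H - A. f i \<in> A} \<le> T} = (\<Union>j\<in>?J. ?F j)" by auto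
  then have "card {f \<in> injections H H. card {i \<in> H - A. f i \<in> A} \<le> T} \<le> (\<Sum>j\<in>?J. card (?F j))"
    using card_UN_le[of ?J ?F] by simp
  also have "\<dots> \<le> (\<Sum>j\<in>?J. (M choose j)\<^sup>2 * (fact M)\<^sup>2)"
    by (intro sum_mono card_injections_crossing_eq_le assms)
  finally have "real (card {f \<in> injections H H. card {i \<in> H - A. f i \<in> A} \<le> T})
      \<le> real (\<Sum>j\<in>?J. (M choose j)\<^sup>2 * (fact M)\<^sup>2)" by linarith
  also have "\<dots> = (\<Sum>j\<in>?J. (real (M choose j))\<^sup>2 * (fact M)\<^sup>2)" by simp
  also have "\<dots> \<le> (\<Sum>j\<in>?J. ((1 + s) ^ M / s ^ T)\<^sup>2 * (fact M)\<^sup>2)"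
    using s by (intro sum_mono mult_right_mono power_mono binomial_le_chernoff) auto
  also have "\<dots> = real (card ?J) * (((1 + s) ^ M / s ^ T)\<^sup>2 * (fact M)\<^sup>2)" by simp
  also have "\<dots> \<le> (real M + 1) * (((1 + s) ^ M / s ^ T)\<^sup>2 * (fact M)\<^sup>2)"
  proof (rule mult_right_mono)
    have "card ?J \<le> card {..M}" by (intro card_mono) auto
    then show "real (card ?J) \<le> real M + 1" by simp
  qed simp
  finally show ?thesis by (simp add: mult_ac)
qed

text \<open>Arcs entering \<open>A\<close>, counted through half-arcs and hence with multiplicity: a
  general permutation may produce multiple arcs.\<close>

definition crossings :: "nat \<Rightarrow> (nat \<Rightarrow> nat) \<Rightarrow> nat \<Rightarrow> nat set \<Rightarrow> nat" where
  "crossings d f k A = card {i. i < k \<and> i div d \<notin> A \<and> f i div d \<in> A}"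

text \<open>The half-arcs owned by \<open>A\<close> are exactly half of \<open>H\<close>, so the
  previous estimate applies with \<open>M = d * m\<close>.\<close>

lemma card_low_crossing_permutations_le:
  fixes s :: real and d m :: nat
  defines "H \<equiv> {..<d * (2 * m)}"
  assumes "d > 0" and s: "0 < s" "s \<le> 1" and A: "A \<subseteq> {..<2 * m}" "card A = m"
  shows "real (card {f \<in> injections H H. crossings d f (d * (2 * m)) A \<le> T})
      \<le> (real (d * m) + 1) * (fact (d * m))\<^sup>2 * ((1 + s) ^ (d * m) / s ^ T)\<^sup>2"
proof -
  let ?A = "{j. j div d \<in> A}"
  have finA: "finite A" using A by (rule_tac finite_subset) auto
  have sub: "?A \<subseteq> H"
  proof
    fix j assume "j \<in> ?A"
    then have "j div d < 2 * m" using A by auto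
    then show "j \<in> H" using \<open>d > 0\<close> by (simp add: H_def div_less_iff_less_mult mult.commute)
  qed
  have cA: "card ?A = d * m" using card_div_vimage[OF \<open>d > 0\<close> finA] A by simp
  have cB: "card (H - ?A) = d * m"
    using sub cA finite_div_vimage[OF \<open>d > 0\<close> finA] by (simp add: card_Diff_subset H_def)
  have "{i. i < d * (2 * m) \<and> i div d \<notin> A \<and> f i div d \<in> A} = {i \<in> H - ?A. f i \<in> ?A}" for f
    by (auto simp: H_def)
  then have "crossings d f (d * (2 * m)) A = card {i \<in> H - ?A. f i \<in> ?A}" for f
    by (simp only: crossings_def)
  moreover have "finite H" by (simp add: H_def)
  ultimately show ?thesis
    using card_injections_crossing_le[OF _ sub cA cB s] by simp
qed

text \<open>Union bound over the bisections. If the claim failed, every good partial pairing would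
  be the restriction of a permutation with few crossings for some \<open>A\<close>, and there are
  too few such permutations.\<close>

lemma exists_good_pairing_with_crossings:
  fixes s :: real and d m g T :: nat
  defines "D \<equiv> d * conflict_bound g d" and "N \<equiv> d * (2 * m)"
  assumes d: "d > 0" and s: "0 < s" "s \<le> 1"
    and count: "4 ^ m * ((real (d * m) + 1) * (fact (d * m))\<^sup>2 * ((1 + s) ^ (d * m) / s ^ (T + D))\<^sup>2)
        < fact (N - D)"
  shows "\<exists>f \<in> good_pairings d g N (N - D).
           \<forall>A. A \<subseteq> {..<2 * m} \<and> card A = m \<longrightarrow> T < crossings d f (N - D) A"
proof (rule ccontr)
  assume "\<not> ?thesis"
  then have bad: "\<exists>A. A \<subseteq> {..<2 * m} \<and> card A = m \<and> crossings d f (N - D) A \<le> T"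
    if "f \<in> good_pairings d g N (N - D)" for f
    using that by (meson not_less)
  let ?A = "{A. A \<subseteq> {..<2 * m} \<and> card A = m}"
  let ?B = "\<lambda>A. {f \<in> injections {..<N} {..<N}. crossings d f N A \<le> T + D}"
  have finA: "finite ?A" by (rule finite_subset[of _ "Pow {..<2 * m}"]) auto
  have cardA: "card ?A \<le> 4 ^ m"
  proof -
    have "card ?A \<le> card (Pow {..<2 * m})" by (intro card_mono) auto
    also have "\<dots> = 4 ^ m" by (simp add: card_Pow power_mult)
    finally show ?thesis .
  qed
  have finB: "finite (?B A)" for A by (simp add: finite_injections)
  have "good_pairings d g N (N - D) \<subseteq> (\<lambda>h. restrict h {..<N - D}) ` (\<Union>A\<in>?A. ?B A)"
  proof
    fix f assume f: "f \<in> good_pairings d g N (N - D)"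
    then obtain A where A: "A \<subseteq> {..<2 * m}" "card A = m" "crossings d f (N - D) A \<le> T"
      using bad by blast
    have "f \<in> injections {..<N - D} {..<N}" using f by (simp add: good_pairings_def)
    then obtain h where h: "h \<in> injections {..<N} {..<N}" and hf: "restrict h {..<N - D} = f"
      by (rule injections_extend[rotated 2]) auto
    \<comment> \<open>The extension pairs at most \<open>D\<close> further half-arcs, each adding at
      most one crossing; hence the threshold \<open>T + D\<close>.\<close>
    have "{i. i < N \<and> i div d \<notin> A \<and> h i div d \<in> A}
        \<subseteq> {i. i < N - D \<and> i div d \<notin> A \<and> f i div d \<in> A} \<union> {N - D..<N}"
      unfolding hf[symmetric] by auto
    then have "crossings d h N A \<le> card ({i. i < N - D \<and> i div d \<notin> A \<and> f i div d \<in> A} \<union> {N - D..<N})"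
      unfolding crossings_def by (intro card_mono) auto
    also have "\<dots> \<le> crossings d f (N - D) A + card {N - D..<N}"
      unfolding crossings_def by (rule card_Un_le)
    also have "\<dots> \<le> T + D" using A by simp
    finally show "f \<in> (\<lambda>h. restrict h {..<N - D}) ` (\<Union>A\<in>?A. ?B A)"
      using h hf A by blast
  qed
  then have "card (good_pairings d g N (N - D)) \<le> card (\<Union>A\<in>?A. ?B A)"
    using finA finB by (intro surj_card_le) auto
  also have "\<dots> \<le> (\<Sum>A\<in>?A. card (?B A))" using finA by (rule card_UN_le)
  finally have "real (card (good_pairings d g N (N - D))) \<le> real (\<Sum>A\<in>?A. card (?B A))"
    by (rule of_nat_mono)
  also have "\<dots> = (\<Sum>A\<in>?A. real (card (?B A)))" by (rule of_nat_sum)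
  also have "\<dots> \<le> (\<Sum>A\<in>?A. (real (d * m) + 1) * (fact (d * m))\<^sup>2 * ((1 + s) ^ (d * m) / s ^ (T + D))\<^sup>2)"
    unfolding N_def by (intro sum_mono card_low_crossing_permutations_le d s) auto
  also have "\<dots> = real (card ?A) * ((real (d * m) + 1) * (fact (d * m))\<^sup>2 * ((1 + s) ^ (d * m) / s ^ (T + D))\<^sup>2)"
    by simp
  also have "\<dots> \<le> 4 ^ m * ((real (d * m) + 1) * (fact (d * m))\<^sup>2 * ((1 + s) ^ (d * m) / s ^ (T + D))\<^sup>2)"
  proof (rule mult_right_mono)
    show "real (card ?A) \<le> 4 ^ m" using of_nat_mono[OF cardA, where 'a = real] by simp
  qed simp
  also have "\<dots> < fact (N - D)" by (rule count)
  also have "\<dots> \<le> real (card (good_pairings d g N (N - D)))"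
    using of_nat_mono[OF card_good_pairings_ge[OF d, of N g], where 'a = real] by (simp add: D_def)
  finally show False by simp
qed

section \<open>The Chernoff bound\<close>

text \<open>The Taylor series are compared term by term, using that \<open>2 ^ n * fact n\<close> is
  at most \<open>fact (2 * n)\<close>. The vanishing odd terms of the series of \<open>cosh\<close>
  are removed by reindexing.\<close>

lemma cosh_le_exp_half_square: "cosh x \<le> exp (x\<^sup>2 / 2)" for x :: real
proof -
  let ?a = "\<lambda>n. if even n then x ^ n /\<^sub>R fact n else 0"
  have "strict_mono (\<lambda>n::nat. 2 * n)" by (simp add: strict_mono_def)
  moreover have "?a n = 0" if "n \<notin> range (\<lambda>n. 2 * n)" for n
    using that by (auto elim!: evenE)
  ultimately have "(\<lambda>n. ?a (2 * n)) sums cosh x"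
    using cosh_converges[of x] by (subst sums_mono_reindex) auto
  then have c: "(\<lambda>n. x ^ (2 * n) /\<^sub>R fact (2 * n)) sums cosh x" by simp
  have e: "(\<lambda>n. (x\<^sup>2 / 2) ^ n /\<^sub>R fact n) sums exp (x\<^sup>2 / 2)" by (rule exp_converges)
  have "x ^ (2 * n) /\<^sub>R fact (2 * n) \<le> (x\<^sup>2 / 2) ^ n /\<^sub>R fact n" for n
  proof -
    have "(2::real) ^ n * fact n \<le> fact (2 * n)"
    proof (induction n)
      case (Suc n)
      have "(2::real) ^ Suc n * fact (Suc n) = (2 * real n + 2) * (2 ^ n * fact n)"
        by (simp add: algebra_simps)
      also have "\<dots> \<le> (2 * real n + 2) * fact (2 * n)"
        using Suc by (intro mult_left_mono) auto
      also have "\<dots> \<le> (2 * real n + 2) * ((2 * real n + 1) * fact (2 * n))"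
        by (intro mult_left_mono) (auto simp: algebra_simps)
      also have "\<dots> = fact (2 * Suc n)" by (simp add: algebra_simps)
      finally show ?case .
    qed simp
    then have "(x\<^sup>2) ^ n / fact (2 * n) \<le> (x\<^sup>2) ^ n / (2 ^ n * fact n)"
      by (intro divide_left_mono) auto
    moreover have "x ^ (2 * n) /\<^sub>R fact (2 * n) = (x\<^sup>2) ^ n / fact (2 * n)"
      unfolding power_mult real_scaleR_def divide_inverse by (rule mult.commute)
    moreover have "(x\<^sup>2 / 2) ^ n /\<^sub>R fact n = (x\<^sup>2) ^ n / (2 ^ n * fact n)"
      by (simp add: power_divide field_simps)
    ultimately show ?thesis by (simp only:)
  qed
  from sums_le[OF this c e] show ?thesis .
qed

text \<open>Taking out \<open>exp (- u / 2)\<close> leaves twice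
  \<open>cosh (u / 2)\<close>.\<close>

lemma one_plus_exp_minus_le: "1 + exp (- u) \<le> 2 * exp (- u / 2 + u\<^sup>2 / 8)" for u :: real
proof -
  have "1 + exp (- u) = 2 * exp (- u / 2) * cosh (u / 2)"
  proof -
    have "exp (- u / 2) * exp (u / 2) = 1" "exp (- u / 2) * exp (- (u / 2)) = exp (- u)"
      by (simp_all flip: exp_add)
    then show ?thesis by (simp add: cosh_def distrib_left)
  qed
  also have "\<dots> \<le> 2 * exp (- u / 2) * exp ((u / 2)\<^sup>2 / 2)"
    by (intro mult_left_mono cosh_le_exp_half_square) auto
  also have "\<dots> = 2 * exp (- u / 2 + u\<^sup>2 / 8)"
    by (simp add: power_divide flip: exp_add)
  finally show ?thesis .
qed

section \<open>Asymptotic estimates for the count\<close>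

lemma power_times_geometric_tendsto_0:
  fixes q :: real
  assumes "0 < q" "q < 1"
  shows "(\<lambda>m. real m ^ k * q ^ m) \<longlonglongrightarrow> 0"
proof -
  define c where "c = - ln q"
  have c: "c > 0" using assms by (simp add: c_def)
  have "filterlim (\<lambda>m. c * real m) at_top sequentially"
    using c by (intro filterlim_tendsto_pos_mult_at_top[OF tendsto_const] filterlim_real_sequentially) auto
  then have "(\<lambda>m. (c * real m) ^ k / exp (c * real m)) \<longlonglongrightarrow> 0"
    by (rule filterlim_compose[OF tendsto_power_div_exp_0])
  then have "(\<lambda>m. (1 / c ^ k) * ((c * real m) ^ k / exp (c * real m))) \<longlonglongrightarrow> (1 / c ^ k) * 0"
    by (intro tendsto_mult tendsto_const)
  moreover have "(1 / c ^ k) * ((c * real m) ^ k / exp (c * real m)) = real m ^ k * q ^ m" for m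
  proof -
    have "exp (c * real m) = inverse (q ^ m)"
      using assms by (simp add: c_def exp_minus mult.commute[of _ "real m"] exp_of_nat_mult)
    then show ?thesis using c by (simp add: power_mult_distrib divide_inverse)
  qed
  ultimately show ?thesis by simp
qed


lemma fact_le_power_mult_fact_diff:
  assumes "k \<le> n"
  shows "fact n \<le> real n ^ k * fact (n - k)"
  using assms
proof (induction k)
  case (Suc k)
  have "(fact (n - k) :: real) = real (n - k) * fact (n - Suc k)"
    using Suc.prems fact_Suc[of "n - Suc k", where 'a = real] by (simp add: Suc_diff_Suc)
  also have "\<dots> \<le> real n * fact (n - Suc k)" by (intro mult_right_mono) auto
  finally have "real n ^ k * fact (n - k) \<le> real n ^ k * (real n * fact (n - Suc k))"
    by (intro mult_left_mono) auto
  moreover have "fact n \<le> real n ^ k * fact (n - k)" using Suc by simp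
  ultimately show ?case by (simp add: mult_ac)
qed simp

text \<open>The central binomial coefficient is at least \<open>4 ^ M / (2 * M)\<close>, so
  \<open>4 ^ M\<close> times the squared factorial is at most \<open>2 * M * fact (2 * M)\<close>.
  Dropping \<open>D\<close> factors of that factorial costs at most
  \<open>(2 * M) ^ D\<close>.\<close>

lemma fact_square_le:
  assumes "M > 0" and "D \<le> 2 * M"
  shows "(fact M)\<^sup>2 * 4 ^ M \<le> real (2 * M) ^ Suc D * fact (2 * M - D)"
proof -
  have "(fact M)\<^sup>2 * 4 ^ M \<le> (fact M)\<^sup>2 * (real (2 * M) * real (2 * M choose M))"
    using central_binomial_lower_bound[OF assms(1)] assms(1)
    by (intro mult_left_mono) (simp_all add: field_simps)
  also have "\<dots> = real (2 * M) * fact (2 * M)"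
  proof -
    have "fact M * fact M * (2 * M choose M) = fact (2 * M)"
      using binomial_fact_lemma[of M "2 * M"] by simp
    then have "fact M * fact M * real (2 * M choose M) = fact (2 * M)"
      by (metis of_nat_fact of_nat_mult)
    moreover have "(fact M)\<^sup>2 * (a * b) = a * (fact M * fact M * b)" for a b :: real
      by (simp add: power2_eq_square)
    ultimately show ?thesis by (simp only:)
  qed
  also have "\<dots> \<le> real (2 * M) * (real (2 * M) ^ D * fact (2 * M - D))"
    by (intro mult_left_mono fact_le_power_mult_fact_diff assms) auto
  finally show ?thesis by simp
qed

text \<open>This is the base of the exponential decay in \<open>m\<close>. The worst case
  \<open>d = 2\<close> amounts to \<open>exp (3 / 2) > 4\<close>, which follows from
  \<open>exp (3 / 4) > 2\<close>.\<close>

lemma four_exp_less_1: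
  assumes "d \<ge> (2::real)"
  shows "4 * exp (- 2 + 1 / d) < 1"
proof -
  have "(2::real) < 1 + 3/4 + (3/4)\<^sup>2 / 2" by (simp add: power2_eq_square)
  also have "\<dots> \<le> exp (3 / 4)" by (rule exp_lower_Taylor_quadratic) simp
  finally have "2 * 2 < exp (3 / 4 :: real) * exp (3 / 4)" by (intro mult_strict_mono) auto
  also have "\<dots> = exp (3 / 2)" by (simp flip: exp_add)
  also have "\<dots> \<le> exp (2 - 1 / d)" using assms by (simp add: field_simps)
  finally have "4 < exp (2 - 1 / d)" by simp
  then have "4 * exp (- 2 + 1 / d) < exp (2 - 1 / d) * exp (- 2 + 1 / d)"
    by (intro mult_strict_right_mono) auto
  also have "\<dots> = 1" by (simp flip: exp_add)
  finally show ?thesis .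
qed

text \<open>
  The exponent per unit of \<open>m\<close> is \<open>d u\<^sup>2 / 4 - u r\<close>, which is minimal at \<open>u = 2 r / d\<close>.
\<close>

lemma chernoff_exponent:
  fixes d m T :: nat
  assumes "d \<ge> 2"
  defines "r \<equiv> sqrt (2 * real d - 1)"
  defines "\<epsilon> \<equiv> (2 * real d - 2 * r) / (8 * real d)" and "u \<equiv> 2 * r / real d"
  assumes T: "real T \<le> \<epsilon> * real (d * (2 * m)) + c"
  shows "4 ^ m * ((1 + exp (- u)) ^ (d * m) / exp (- u) ^ T)\<^sup>2
      \<le> 4 ^ (d * m) * exp (2 * u * c) * (4 * exp (- 2 + 1 / real d)) ^ m"
proof -
  have d: "real d \<ge> 2" using assms by simp
  have r: "r\<^sup>2 = 2 * real d - 1" "r \<ge> 0" using d by (auto simp: r_def)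
  have u: "u \<ge> 0" using r by (simp add: u_def)
  have "((1 + exp (- u)) ^ (d * m))\<^sup>2 \<le> ((2 * exp (- u / 2 + u\<^sup>2 / 8)) ^ (d * m))\<^sup>2"
    by (intro power_mono one_plus_exp_minus_le) (auto intro: add_nonneg_nonneg)
  also have "\<dots> = 4 ^ (d * m) * exp (real (2 * (d * m)) * (- u / 2 + u\<^sup>2 / 8))"
  proof -
    have "((2 * x) ^ n)\<^sup>2 = 4 ^ n * x ^ (2 * n)" for x :: real and n
      by (simp add: power_mult_distrib power_mult[symmetric] mult.commute[of n])
         (simp add: power_mult)
    then show ?thesis by (simp only: exp_of_nat_mult)
  qed
  finally have A: "((1 + exp (- u)) ^ (d * m))\<^sup>2
      \<le> 4 ^ (d * m) * exp (real (2 * (d * m)) * (- u / 2 + u\<^sup>2 / 8))" .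
  have "1 / (exp (- u) ^ T)\<^sup>2 = exp (2 * u * real T)"
  proof -
    have "(exp (- u) ^ T)\<^sup>2 = exp (- (2 * u * real T))"
      by (simp add: exp_of_nat_mult[symmetric] power2_eq_square algebra_simps flip: exp_add)
    then show ?thesis by (simp add: exp_minus divide_inverse)
  qed
  also have "\<dots> \<le> exp (2 * u * (\<epsilon> * real (d * (2 * m)) + c))"
    using T u by (simp add: mult_left_mono)
  finally have B: "1 / (exp (- u) ^ T)\<^sup>2 \<le> exp (2 * u * (\<epsilon> * real (d * (2 * m)) + c))" .
  have "((1 + exp (- u)) ^ (d * m) / exp (- u) ^ T)\<^sup>2
      = ((1 + exp (- u)) ^ (d * m))\<^sup>2 * (1 / (exp (- u) ^ T)\<^sup>2)"
    by (simp add: power_divide)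
  also have "\<dots> \<le> (4 ^ (d * m) * exp (real (2 * (d * m)) * (- u / 2 + u\<^sup>2 / 8)))
      * exp (2 * u * (\<epsilon> * real (d * (2 * m)) + c))"
    by (intro mult_mono A B) auto
  also have "\<dots> = 4 ^ (d * m) * exp (2 * u * c)
      * exp (real m * (2 * real d * (- u / 2 + u\<^sup>2 / 8) + 4 * u * \<epsilon> * real d))"
    by (simp add: algebra_simps flip: exp_add)
  \<comment> \<open>Since \<open>4 * \<epsilon> * d = d - r\<close>, the left side is
    \<open>d * u^2 / 4 - u * r\<close>; now insert \<open>u = 2 * r / d\<close>.\<close>
  also have "2 * real d * (- u / 2 + u\<^sup>2 / 8) + 4 * u * \<epsilon> * real d = - r\<^sup>2 / real d"
    using d by (simp add: u_def \<epsilon>_def field_simps power2_eq_square)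
  also have "\<dots> = - 2 + 1 / real d" using d by (simp add: r field_simps)
  also have "exp (real m * (- 2 + 1 / real d)) = exp (- 2 + 1 / real d) ^ m"
    by (rule exp_of_nat_mult)
  finally have "4 ^ m * ((1 + exp (- u)) ^ (d * m) / exp (- u) ^ T)\<^sup>2
      \<le> 4 ^ m * (4 ^ (d * m) * exp (2 * u * c) * exp (- 2 + 1 / real d) ^ m)"
    by (intro mult_left_mono) auto
  then show ?thesis by (simp add: power_mult_distrib mult_ac)
qed

text \<open>With \<open>s = exp (- u)\<close>, the quotient of the two sides is at most a constant
  times \<open>m ^ (D + 2) * q ^ m\<close> for large \<open>m\<close>, where
  \<open>q < 1\<close>.\<close>

lemma counting_inequality:
  fixes d D :: nat
  assumes "d \<ge> 2"
  defines "\<epsilon> \<equiv> (2 * real d - 2 * sqrt (2 * real d - 1)) / (8 * real d)"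
  obtains s :: real where "0 < s" "s \<le> 1"
    "\<forall>\<^sub>F m in sequentially.
       4 ^ m * ((real (d * m) + 1) * (fact (d * m))\<^sup>2
         * ((1 + s) ^ (d * m) / s ^ (nat \<lceil>\<epsilon> * real (d * (2 * m))\<rceil> + D + D))\<^sup>2)
       < fact (d * (2 * m) - D)"
proof -
  define u where "u = 2 * sqrt (2 * real d - 1) / real d"
  define q where "q = 4 * exp (- 2 + 1 / real d)"
  \<comment> \<open>Twice \<open>D\<close> from the exponent, plus 1 for rounding up.\<close>
  define c where "c = real (2 * D + 1)"
  \<comment> \<open>The factor \<open>(2 * d) ^ (D + 2)\<close> comes from
    \<open>(2 * M) ^ (D + 2)\<close> with \<open>M = d * m\<close>.\<close>
  define K where "K = exp (2 * u * c) * (2 * real d) ^ (D + 2)"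
  have q: "0 < q" "q < 1" using four_exp_less_1[of "real d"] assms(1) by (auto simp: q_def)
  have u: "u \<ge> 0" using assms(1) by (simp add: u_def)
  \<comment> \<open>Ensures that \<open>nat\<close> does not truncate a negative ceiling.\<close>
  have \<epsilon>: "\<epsilon> \<ge> 0"
  proof -
    have "2 * real d - 1 \<le> (real d)\<^sup>2" using zero_le_power2[of "real d - 1"]
      by (simp add: power2_eq_square algebra_simps)
    then have "sqrt (2 * real d - 1) \<le> real d" by (simp add: real_le_lsqrt)
    then show ?thesis by (simp add: \<epsilon>_def)
  qed
  have "(\<lambda>m. K * (real m ^ (D + 2) * q ^ m)) \<longlonglongrightarrow> K * 0"
    by (intro tendsto_mult tendsto_const power_times_geometric_tendsto_0 q)
  then have "\<forall>\<^sub>F m in sequentially. K * (real m ^ (D + 2) * q ^ m) < 1"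
    by (rule order_tendstoD) simp
  moreover have "\<forall>\<^sub>F m in sequentially. m \<ge> D + 1" by (rule eventually_ge_at_top)
  ultimately have "\<forall>\<^sub>F m in sequentially.
       4 ^ m * ((real (d * m) + 1) * (fact (d * m))\<^sup>2
         * ((1 + exp (- u)) ^ (d * m) / exp (- u) ^ (nat \<lceil>\<epsilon> * real (d * (2 * m))\<rceil> + D + D))\<^sup>2)
       < fact (d * (2 * m) - D)"
  proof eventually_elim
    case (elim m)
    define M where "M = d * m"
    let ?T = "nat \<lceil>\<epsilon> * real (d * (2 * m))\<rceil> + D + D"
    have "1 * m \<le> d * m" using assms(1) by (intro mult_right_mono) auto
    then have "m \<le> M" by (simp add: M_def)
    then have M: "M > 0" "D \<le> 2 * M" using elim by linarith+
    have "real ?T \<le> \<epsilon> * real (d * (2 * m)) + c"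
    proof -
      have "real (nat \<lceil>\<epsilon> * real (d * (2 * m))\<rceil>) \<le> \<epsilon> * real (d * (2 * m)) + 1"
        using \<epsilon> by (simp add: of_nat_nat del: of_nat_mult) 
      then show ?thesis by (simp add: c_def)
    qed
    then have "4 ^ m * ((1 + exp (- u)) ^ M / exp (- u) ^ ?T)\<^sup>2 \<le> 4 ^ M * exp (2 * u * c) * q ^ m"
      using chernoff_exponent[OF assms(1), of ?T m c] unfolding u_def q_def \<epsilon>_def M_def by simp
    then have "((real M + 1) * (fact M)\<^sup>2) * (4 ^ m * ((1 + exp (- u)) ^ M / exp (- u) ^ ?T)\<^sup>2)
        \<le> ((real M + 1) * (fact M)\<^sup>2) * (4 ^ M * exp (2 * u * c) * q ^ m)"
      by (intro mult_left_mono) auto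
    also have "\<dots> = (real M + 1) * exp (2 * u * c) * q ^ m * ((fact M)\<^sup>2 * 4 ^ M)" by simp
    also have "\<dots> \<le> (real M + 1) * exp (2 * u * c) * q ^ m * (real (2 * M) ^ Suc D * fact (2 * M - D))"
      using q M by (intro mult_left_mono fact_square_le) auto
    also have "\<dots> \<le> real (2 * M) * exp (2 * u * c) * q ^ m * (real (2 * M) ^ Suc D * fact (2 * M - D))"
      using q M by (intro mult_right_mono) auto
    also have "\<dots> = K * (real m ^ (D + 2) * q ^ m) * fact (2 * M - D)"
      by (simp add: K_def M_def power_mult_distrib)
    also have "\<dots> < 1 * fact (2 * M - D)"
      using elim by (intro mult_strict_right_mono) auto
    finally show ?case by (simp add: M_def mult_ac)
  qed
  then show thesis using that[of "exp (- u)"] u by simp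
qed

section \<open>Regular digraphs with large bisections\<close>

lemma exists_regular_short_cycle_free_high_cut:
  fixes d g :: nat
  assumes d: "d \<ge> 2"
  defines "\<epsilon> \<equiv> (2 * real d - 2 * sqrt (2 * real d - 1)) / (8 * real d)"
  obtains m :: nat and E :: "nat rel" where "m > 0" "E \<subseteq> {..<2 * m} \<times> {..<2 * m}"
    and "short_cycle_free g E" "degrees_le d E" "card E = d * (2 * m)"
    and "\<And>A. A \<subseteq> {..<2 * m} \<Longrightarrow> card A = m \<Longrightarrow>
           \<epsilon> * real (card E) \<le> real (card (E \<inter> ({..<2 * m} - A) \<times> A))"
proof -
  define D where "D = d * conflict_bound g d"
  obtain s :: real where s: "0 < s" "s \<le> 1" and ev:
    "\<forall>\<^sub>F m in sequentially.
       4 ^ m * ((real (d * m) + 1) * (fact (d * m))\<^sup>2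
         * ((1 + s) ^ (d * m) / s ^ (nat \<lceil>\<epsilon> * real (d * (2 * m))\<rceil> + D + D))\<^sup>2)
       < fact (d * (2 * m) - D)"
    using counting_inequality[OF d, of D] unfolding \<epsilon>_def by blast
  \<comment> \<open>The bound \<open>m \<ge> 3 * D + 1\<close> gives \<open>N > 3 * D\<close>, so
    that the \<open>N - D\<close> arcs of the partial pairing exceed the \<open>2 * D\<close>
    required for switching.\<close>
  obtain m where
    count: "4 ^ m * ((real (d * m) + 1) * (fact (d * m))\<^sup>2
         * ((1 + s) ^ (d * m) / s ^ (nat \<lceil>\<epsilon> * real (d * (2 * m))\<rceil> + D + D))\<^sup>2)
       < fact (d * (2 * m) - D)" and m: "m \<ge> 3 * D + 1"
    using eventually_happens[OF eventually_conj[OF ev eventually_ge_at_top[of "3 * D + 1"]]] by auto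
  define N where "N = d * (2 * m)"
  \<comment> \<open>The summand \<open>D\<close> is a reserve for the arcs that the switches may
    destroy.\<close>
  define T where "T = nat \<lceil>\<epsilon> * real N\<rceil> + D"
  let ?V = "{..<2 * m}"
  have dpos: "d > 0" using d by simp
  have "1 * (2 * m) \<le> N" unfolding N_def using dpos by (intro mult_right_mono) auto
  then have N: "3 * D < N" using m by linarith
  obtain f where f: "f \<in> good_pairings d g N (N - D)"
    and cross: "\<And>A. A \<subseteq> ?V \<Longrightarrow> card A = m \<Longrightarrow> T < crossings d f (N - D) A"
    using exists_good_pairing_with_crossings[OF dpos s, of m T g] count
    unfolding N_def D_def T_def by blast
  define E where "E = half_arc d f ` {..<N - D}"
  have f': "f \<in> {..<N - D} \<rightarrow>\<^sub>E {..<N}" "inj_on f {..<N - D}" "inj_on (half_arc d f) {..<N - D}"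
    and scf: "short_cycle_free g E"
    using f by (auto simp: good_pairings_def injections_def E_def)
  have vert: "i div d < 2 * m" if "i < N" for i
    using that dpos by (simp add: N_def div_less_iff_less_mult mult.commute)
  have vert': "i div d < 2 * m" if "i < N - D" for i using that by (intro vert) simp
  have fN: "f i < N" if "i < N - D" for i using f'(1) that by auto
  have sub: "E \<subseteq> ?V \<times> ?V"
    unfolding E_def half_arc_def using vert vert' fN by auto
  have deg: "degrees_le d E" unfolding E_def using dpos f'(2) by (rule degrees_le_half_arcs)
  have card: "card E = N - D" unfolding E_def using f'(3) by (simp add: card_image)
  have cN: "card E + D = d * card ?V" using card N by (simp add: N_def)
  have big: "2 * (d * conflict_bound g d) < card E"
    unfolding D_def[symmetric] using card N by linarith
  obtain E' where E': "E' \<subseteq> ?V \<times> ?V" "short_cycle_free g E'" "degrees_le d E'"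
    "card E' = d * card ?V" "card (E - E') \<le> D"
    using regular_completion[OF finite_lessThan sub scf deg cN big] by blast
  have finE: "finite E" by (simp add: E_def)
  have "\<epsilon> * real (card E') \<le> real (card (E' \<inter> (?V - A) \<times> A))"
    if A: "A \<subseteq> ?V" "card A = m" for A
  proof -
    let ?B = "(?V - A) \<times> A"
    \<comment> \<open>Distinct half-arcs give distinct arcs here, so crossings of the pairing are
      arcs of \<open>E\<close> counted once.\<close>
    have "half_arc d f ` {i. i < N - D \<and> i div d \<notin> A \<and> f i div d \<in> A} \<subseteq> E \<inter> ?B"
      unfolding E_def half_arc_def using vert' by auto
    then have "card (half_arc d f ` {i. i < N - D \<and> i div d \<notin> A \<and> f i div d \<in> A}) \<le> card (E \<inter> ?B)"
      using finE by (intro card_mono) auto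
    moreover have "card (half_arc d f ` {i. i < N - D \<and> i div d \<notin> A \<and> f i div d \<in> A})
        = crossings d f (N - D) A"
      unfolding crossings_def using f'(3) by (intro card_image) (auto simp: inj_on_def)
    ultimately have "T < card (E \<inter> ?B)" using cross[OF A] by linarith
    also have "card (E \<inter> ?B) \<le> card (E' \<inter> ?B \<union> (E - E'))"
      using finE A finite_subset[OF E'(1)] by (intro card_mono) auto
    also have "\<dots> \<le> card (E' \<inter> ?B) + card (E - E')" by (rule card_Un_le)
    finally have "nat \<lceil>\<epsilon> * real N\<rceil> \<le> card (E' \<inter> ?B)" using E'(5) unfolding T_def by linarith
    then have "\<epsilon> * real N \<le> real (card (E' \<inter> ?B))" by linarith
    then show ?thesis using E'(4) by (simp add: N_def)
  qed
  then show thesis using that[of m E'] E' m by simp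
qed

section \<open>From bisections to feedback arc sets\<close>

lemma exists_predecessor_closed_subset:
  assumes "finite V" and "R \<subseteq> V \<times> V" and "acyclic R" and "k \<le> card V"
  shows "\<exists>A\<subseteq>V. card A = k \<and> (\<forall>(x, y) \<in> R. y \<in> A \<longrightarrow> x \<in> A)"
  using assms(4)
proof (induction k)
  case 0
  show ?case by (intro exI[of _ "{}"]) auto
next
  case (Suc k)
  then obtain A where A: "A \<subseteq> V" "card A = k" "\<forall>(x, y) \<in> R. y \<in> A \<longrightarrow> x \<in> A" by auto
  \<comment> \<open>Add a vertex that is minimal among those left: all its predecessors are already
    in \<open>A\<close>. Thus \<open>A\<close> grows as an initial segment of a topological
    order.\<close>
  have "wf R" using assms by (intro finite_acyclic_wf) (auto intro: finite_subset)
  moreover have "V - A \<noteq> {}" using A Suc.prems by auto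
  ultimately obtain z where z: "z \<in> V - A" "\<And>x. (x, z) \<in> R \<Longrightarrow> x \<notin> V - A"
    by (metis ex_in_conv wfE_min)
  have "card (insert z A) = Suc k"
    using z A assms(1) by (simp add: finite_subset)
  moreover have "\<forall>(x, y) \<in> R. y \<in> insert z A \<longrightarrow> x \<in> insert z A"
    using z(2) A(3) assms(2) by fastforce
  ultimately show ?case using z A by (intro exI[of _ "insert z A"]) auto
qed

section \<open>Relations as digraphs\<close>

definition pair_digraph :: "'a set \<Rightarrow> 'a rel \<Rightarrow> ('a, 'a \<times> 'a) pre_digraph" where
  "pair_digraph V E = \<lparr>verts = V, arcs = E, tail = fst, head = snd\<rparr>"

lemma pair_digraph_simps [simp]:
  "verts (pair_digraph V E) = V" "arcs (pair_digraph V E) = E"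
  "tail (pair_digraph V E) = fst" "head (pair_digraph V E) = snd"
  "(pair_digraph V E)\<lparr>arcs := E'\<rparr> = pair_digraph V E'"
  by (simp_all add: pair_digraph_def)

lemma relpow_if_cas:
  "pre_digraph.cas (pair_digraph V E) u p v \<Longrightarrow> set p \<subseteq> E \<Longrightarrow> (u, v) \<in> E ^^ length p"
proof (induction p arbitrary: u)
  case Nil
  then show ?case by (simp add: pre_digraph.cas.simps)
next
  case (Cons e p)
  then have "(u, snd e) \<in> E" "(snd e, v) \<in> E ^^ length p"
    by (auto simp: pre_digraph.cas.simps)
  then show ?case using relpow_Suc_I2 by fastforce
qed

lemma cas_if_relpow:
  "(u, v) \<in> E ^^ l \<Longrightarrow> \<exists>p. length p = l \<and> set p \<subseteq> E \<and> pre_digraph.cas (pair_digraph V E) u p v"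
proof (induction l arbitrary: u)
  case 0
  then show ?case by (simp add: pre_digraph.cas.simps)
next
  case (Suc l)
  from Suc.prems obtain w where w: "(u, w) \<in> E" "(w, v) \<in> E ^^ l" by (metis relpow_Suc_D2)
  then obtain p where "length p = l" "set p \<subseteq> E" "pre_digraph.cas (pair_digraph V E) w p v"
    using Suc.IH by blast
  then show ?case using w(1)
    by (intro exI[of _ "(u, w) # p"]) (simp add: pre_digraph.cas.simps)
qed

lemma directed_girth_pair_digraph_ge:
  assumes "short_cycle_free g E"
  shows "enat g \<le> directed_girth (pair_digraph V E)"
  unfolding directed_girth_def
proof (rule INF_greatest)
  fix c assume "c \<in> {c. pre_digraph.cycle (pair_digraph V E) c}"
  then obtain u where "pre_digraph.cas (pair_digraph V E) u c u" "set c \<subseteq> E" "c \<noteq> []"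
    by (auto simp: pre_digraph.cycle_def pre_digraph.awalk_def)
  then have "(u, u) \<in> E ^^ length c" "0 < length c" by (auto intro: relpow_if_cas)
  then have "\<not> length c < g" using assms unfolding short_cycle_free_def by blast
  then show "enat g \<le> enat (length c)" by simp
qed

text \<open>A loop in the transitive closure is a closed walk of positive length, and such a walk
  contains a cycle.\<close>

lemma acyclic_if_acyclic_digraph:
  assumes "E \<subseteq> V \<times> V" and "acyclic_digraph (pair_digraph V E)"
  shows "acyclic E"
proof (rule acyclicI, intro allI notI)
  fix x assume "(x, x) \<in> E\<^sup>+"
  then obtain l where l: "l > 0" "(x, x) \<in> E ^^ l" by (auto simp: trancl_power)
  then obtain p where p: "length p = l" "set p \<subseteq> E" "pre_digraph.cas (pair_digraph V E) x p x"
    using cas_if_relpow by metis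
  have "x \<in> V" using \<open>(x, x) \<in> E\<^sup>+\<close> assms(1) by (metis trancl_subset_Sigma SigmaD1 subsetD)
  interpret wf_digraph "pair_digraph V E"
    using assms(1) by unfold_locales auto
  have "closed_w p"
    using p l \<open>x \<in> V\<close> by (auto simp: closed_w_def awalk_def)
  then show False
    using assms(2) closed_w_imp_cycle unfolding acyclic_digraph_def by blast
qed

text \<open>Without \<open>F\<close> some half \<open>A\<close> of the vertices is closed under
  predecessors, so every arc of \<open>E\<close> entering \<open>A\<close> belongs to
  \<open>F\<close>.\<close>

lemma card_feedback_arc_set_ge:
  assumes "E \<subseteq> {..<2 * m} \<times> {..<2 * m}"
    and cut: "\<And>A. A \<subseteq> {..<2 * m} \<Longrightarrow> card A = m \<Longrightarrow> c \<le> real (card (E \<inter> ({..<2 * m} - A) \<times> A))"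
    and F: "feedback_arc_set (pair_digraph {..<2 * m} E) F"
  shows "c \<le> real (card F)"
proof -
  have FE: "F \<subseteq> E" and "acyclic_digraph (pair_digraph {..<2 * m} (E - F))"
    using F by (auto simp: feedback_arc_set_def)
  then have "acyclic (E - F)" using assms(1) by (intro acyclic_if_acyclic_digraph) auto
  then have "\<exists>A\<subseteq>{..<2 * m}. card A = m \<and> (\<forall>(x, y) \<in> E - F. y \<in> A \<longrightarrow> x \<in> A)"
    using assms(1) by (intro exists_predecessor_closed_subset) auto
  then obtain A where A: "A \<subseteq> {..<2 * m}" "card A = m" "\<forall>(x, y) \<in> E - F. y \<in> A \<longrightarrow> x \<in> A"
    by blast
  have "E \<inter> ({..<2 * m} - A) \<times> A \<subseteq> F" using A(3) by auto
  moreover have "finite F" using FE assms(1) by (meson finite_SigmaI finite_lessThan finite_subset)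
  ultimately have "card (E \<inter> ({..<2 * m} - A) \<times> A) \<le> card F" by (rule card_mono[rotated])
  then show ?thesis using cut[OF A(1,2)] by linarith
qed

text \<open>In an optimal partition each of the \<open>fasd D\<close> disjoint parts is a feedback
  arc set and has at least \<open>fas D\<close> arcs.\<close>

lemma fasd_mult_fas_le:
  assumes "finite (arcs D)"
  shows "fasd D * fas D \<le> card (arcs D)"
proof -
  let ?P = "{P. partition_on (arcs D) P \<and> (\<forall>F \<in> P. feedback_arc_set D F)}"
  have "fasd D \<in> card ` ?P"
    unfolding fasd_def using fasd_candidates[OF assms] by (intro Max_in) auto
  then obtain P where P: "partition_on (arcs D) P" "\<And>F. F \<in> P \<Longrightarrow> feedback_arc_set D F" "fasd D = card P"
    by auto
  have fin: "finite F" if "F \<in> P" for F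
    using P(2)[OF that] assms by (auto simp: feedback_arc_set_def intro: finite_subset)
  have "fas D \<le> card F" if "F \<in> P" for F
    unfolding fas_def using fas_candidates[OF assms] P(2)[OF that] by (intro Min_le) auto
  then have "(\<Sum>F\<in>P. fas D) \<le> (\<Sum>F\<in>P. card F)" by (intro sum_mono)
  also have "\<dots> = card (\<Union>P)"
    using P(1) fin by (intro card_Union_disjoint[symmetric])
      (auto simp: partition_on_def disjoint_def pairwise_def disjnt_def)
  also have "\<Union>P = arcs D" using P(1) by (simp add: partition_on_def)
  finally show ?thesis using P(3) by simp
qed

text \<open>Loops and directed 2-cycles are closed walks of lengths 1 and 2, both below
  \<open>g\<close>.\<close>

lemma oriented_graph_pair_digraph:
  assumes "finite V" and "E \<subseteq> V \<times> V" and "short_cycle_free g E" and "g \<ge> 3"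
  shows "oriented_graph (pair_digraph V E)"
proof -
  have E1: "(x, x) \<notin> E" for x
    using assms(3,4) unfolding short_cycle_free_def by (metis One_nat_def Suc_lessD less_le_trans lessI numeral_3_eq_3 relpow_1 zero_less_Suc)
  have E2: "(y, x) \<notin> E" if "(x, y) \<in> E" for x y
  proof
    assume "(y, x) \<in> E"
    then have "(x, x) \<in> E ^^ 2" using that by (auto simp: numeral_2_eq_2)
    moreover have "(0::nat) < 2" "2 < g" using assms(4) by auto
    ultimately show False using assms(3) unfolding short_cycle_free_def by blast
  qed
  have "finite E" using assms(1,2) by (meson finite_SigmaI finite_subset)
  then show ?thesis
    using assms(1,2) E1 E2
    by unfold_locales (auto simp: arcs_ends_def arc_to_ends_def)
qed

lemma regular_pair_digraph:
  assumes "finite V" and "E \<subseteq> V \<times> V" and "degrees_le d E" and "card E = d * card V"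
  shows "regular_digraph d (pair_digraph V E)"
  unfolding regular_digraph_def
proof (intro ballI conjI)
  fix v assume "v \<in> verts (pair_digraph V E)"
  then have v: "v \<in> V" by simp
  have "in_arcs (pair_digraph V E) v = (\<lambda>x. (x, v)) ` (E\<inverse> `` {v})"
    by (auto simp: in_arcs_def)
  moreover have "card (E\<inverse> `` {v}) = d"
    using assms v by (intro degree_eq_if_card_eq[of V]) (auto simp: degrees_le_converse)
  ultimately show "in_degree (pair_digraph V E) v = d"
    unfolding in_degree_def by (simp add: card_image inj_on_def)
  have "out_arcs (pair_digraph V E) v = (\<lambda>x. (v, x)) ` (E `` {v})"
    by (auto simp: out_arcs_def)
  moreover have "card (E `` {v}) = d"
    using assms v by (intro degree_eq_if_card_eq[of V]) auto
  ultimately show "out_degree (pair_digraph V E) v = d"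
    unfolding out_degree_def by (simp add: card_image inj_on_def)
qed

theorem theorem6:
  fixes g p :: nat
  assumes "g \<ge> 3" and "primepow p" and "odd p" and "[p = 1] (mod 4)"
  shows "\<exists>D :: (nat, nat \<times> nat) pre_digraph.
           oriented_graph D \<and> verts D \<noteq> {} \<and>
           regular_digraph ((p + 1) div 2) D \<and>
           enat g \<le> directed_girth D \<and>
           (real p + 1 - 2 * sqrt (real p)) / (4 * (real p + 1)) * real (card (arcs D)) \<le> real (fas D) \<and>
           real (fasd D) \<le> 4 * (real p + 1) / (real p + 1 - 2 * sqrt (real p))"
proof -
  define d where "d = (p + 1) div 2"
  define \<epsilon> where "\<epsilon> = (real p + 1 - 2 * sqrt (real p)) / (4 * (real p + 1))"
  have p: "p > 1" using assms(2) by (rule primepow_gt_Suc_0[unfolded One_nat_def[symmetric]])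
  have "2 * d = p + 1" using assms(3) by (simp add: d_def)
  then have pd: "real p = 2 * real d - 1" by linarith
  have d: "d \<ge> 2" using p assms(3) \<open>2 * d = p + 1\<close> by (cases "p = 2") auto
  have \<epsilon>d: "\<epsilon> = (2 * real d - 2 * sqrt (2 * real d - 1)) / (8 * real d)"
    unfolding \<epsilon>_def pd by simp
  \<comment> \<open>This square equals \<open>p + 1 - 2 * sqrt p\<close>, so the constant is
    positive and may be inverted.\<close>
  have "(sqrt (real p) - 1)\<^sup>2 > 0" using p by simp
  then have pos: "real p + 1 - 2 * sqrt (real p) > 0" by (simp add: power2_eq_square algebra_simps)
  then have \<epsilon>: "\<epsilon> > 0" by (simp add: \<epsilon>_def)
  obtain m :: nat and E :: "nat rel" where m: "m > 0" and E: "E \<subseteq> {..<2 * m} \<times> {..<2 * m}"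
    and scf: "short_cycle_free g E" and deg: "degrees_le d E" and card: "card E = d * (2 * m)"
    and cut: "\<And>A. A \<subseteq> {..<2 * m} \<Longrightarrow> card A = m \<Longrightarrow>
           \<epsilon> * real (card E) \<le> real (card (E \<inter> ({..<2 * m} - A) \<times> A))"
    using exists_regular_short_cycle_free_high_cut[OF d, of g] unfolding \<epsilon>d by blast
  let ?D = "pair_digraph {..<2 * m} E"
  have finE: "finite (arcs ?D)" using E by (simp add: finite_subset)
  have "fas ?D \<in> card ` {F. feedback_arc_set ?D F}"
    unfolding fas_def using fas_candidates[OF finE] by (intro Min_in) auto
  then obtain F where F: "feedback_arc_set ?D F" "fas ?D = card F" by auto
  have fas: "\<epsilon> * real (card E) \<le> real (fas ?D)"
    unfolding F(2) by (rule card_feedback_arc_set_ge[OF E cut F(1)])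
  \<comment> \<open>Positivity lets \<open>card E\<close> be cancelled from the product of the
    bounds for \<open>fasd\<close> and \<open>fas\<close>.\<close>
  have cE: "real (card E) > 0" using card d m by simp
  have "real (fasd ?D) * (\<epsilon> * real (card E)) \<le> real (fasd ?D) * real (fas ?D)"
    using fas by (intro mult_left_mono) auto
  also have "\<dots> \<le> real (card E)"
    using of_nat_mono[OF fasd_mult_fas_le[OF finE], where 'a = real] by simp
  finally have "real (fasd ?D) * \<epsilon> \<le> 1" using cE by (simp add: mult.assoc[symmetric])
  then have "real (fasd ?D) \<le> 1 / \<epsilon>" using \<epsilon> by (simp add: field_simps)
  also have "1 / \<epsilon> = 4 * (real p + 1) / (real p + 1 - 2 * sqrt (real p))"
    by (simp add: \<epsilon>_def)
  finally have fasd: "real (fasd ?D) \<le> 4 * (real p + 1) / (real p + 1 - 2 * sqrt (real p))" .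
  have "oriented_graph ?D" using E scf assms(1) by (intro oriented_graph_pair_digraph) auto
  moreover have "verts ?D \<noteq> {}" using m by (simp add: lessThan_empty_iff)
  moreover have "regular_digraph ((p + 1) div 2) ?D"
    unfolding d_def[symmetric] using E deg card by (intro regular_pair_digraph) auto
  moreover have "enat g \<le> directed_girth ?D" using scf by (rule directed_girth_pair_digraph_ge)
  moreover have "(real p + 1 - 2 * sqrt (real p)) / (4 * (real p + 1)) * real (card (arcs ?D)) \<le> real (fas ?D)"
    using fas by (simp add: \<epsilon>_def)
  ultimately show ?thesis using fasd by blast
qed

end
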